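(* Let $(\mathsf X,\mathcal B)$ be a measurable space and let $\mathcal P$ and $\mathcal Q$ be nonempty sets of probability measures on it. Then $(\mathcal P,\mathcal Q)$ is sequentially testable if and only if there exist nonempty subfamilies $\mathcal A_m\subseteq\mathcal Q$ and integers $n_m\ge1$ $(m\ge1)$ such that $$\mathcal Q=\bigcup_{m\ge1}\mathcal A_m,\qquad d_{\mathrm{TV}}\big(\mathscr C_{n_m},\mathscr D_{n_m}(\mathcal A_m)\big)>0\quad\text{for every }m.$$
   Context: For a probability measure $R$ on $(\mathsf X,\mathcal B)$, $R^n$ and $R^\infty$ denote i.i.d. product laws on $\mathsf X^n$ and $\mathsf X^{\mathbb N}$; $(X_i)_{i\ge1}$ is the coordinate process and $\mathcal F_n=\sigma(X_1,\dots,X_n)$. A sequential test is an $(\mathcal F_n)$-stopping time $\tau$ with values in $\{1,2,\dots\}\cup\{\infty\}$. It is level-$\alpha$ for $\mathcal P$ if $\sup_{P\in\mathcal P}P^\infty(\tau<\infty)\le\alpha$, and has power one against $Q$ if $Q^\infty(\tau<\infty)=1$. The pair $(\mathcal P,\mathcal Q)$ is called sequentially testable if the following equivalent conditions hold: for some $\alpha\in(0,1)$ there is a level-$\alpha$ test with power one against every $Q\in\mathcal Q$; for every $\alpha\in(0,1)$ there is such a test; there is a countable family $(n_m,h_m)_{m\ge1}$ of bounded measurable $h_m:\mathsf X^{n_m}\to\mathbb R$ with $\sup_{P\in\mathcal P}\mathbb E_{P^{n_m}}h_m\le0$ for every $m$ and such that each $Q\in\mathcal Q$ has $\mathbb E_{Q^{n_m}}h_m>0$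 for some $m$. Let $\mathcal L_n$ be the Banach space of bounded $\mathcal B^{\otimes n}$-measurable real functions on $\mathsf X^n$ with the supremum norm, and $\mathrm{ba}_n=\mathcal L_n^*$ its dual (bounded finitely additive signed measures) with the weak-$*$ topology $\sigma(\mathrm{ba}_n,\mathcal L_n)$. For nonempty $\mathcal A\subseteq\mathcal Q$, $\mathscr C_n$ is the weak-$*$ closure of the convex hull of $\{P^n:P\in\mathcal P\}$ and $\mathscr D_n(\mathcal A)$ is the weak-$*$ closure of the convex hull of $\{Q^n:Q\in\mathcal A\}$ in $\mathrm{ba}_n$; their elements are finitely additive probability measures. For such $\mu,\nu$, $d_{\mathrm{TV}}(\mu,\nu)=\sup\{\mathbb E_\mu f-\mathbb E_\nu f: f\in\mathcal L_n,\ 0\le f\le1\}$, and the distance between two sets is the infimum over pairs. *)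

theory Defs
  imports "HOL-Probability.Probability" "HOL-Library.Extended_Nat"
begin

section \<open>Sequential tests\<close>

text \<open>
  A measurable space is given by a measure \<open>M\<close> of which only \<open>space M\<close> and \<open>sets M\<close> matter;
  \<open>space (prob_algebra M)\<close> is the set of all probability measures on it.
  Coordinates are counted from 0, so the observation \<open>X\<^sub>i\<close> is \<open>\<omega> (i - 1)\<close>, and
  the first \<open>n\<close> observations are those with index in \<open>{..<n}\<close>.
\<close>

definition iid_prod :: "nat \<Rightarrow> 'a measure \<Rightarrow> (nat \<Rightarrow> 'a) measure" where
  "iid_prod n R = (\<Pi>\<^sub>M i\<in>{..<n}. R)"

definition iid_seq :: "'a measure \<Rightarrow> (nat \<Rightarrow> 'a) measure" where
  "iid_seq R = (\<Pi>\<^sub>M i\<in>UNIV. R)"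

text \<open>
  The natural filtration is indexed by \<open>enat\<close> because \<^const>\<open>stopping_time\<close> takes the time index
  and the values of the stopping time from the same type. At \<open>t = \<infinity>\<close> the stopping time condition
  is vacuous.
\<close>

definition coord_filtration :: "'a measure \<Rightarrow> enat \<Rightarrow> (nat \<Rightarrow> 'a) measure" where
  "coord_filtration M t =
     sigma (space (iid_seq M))
       {{\<omega> \<in> space (iid_seq M). \<omega> i \<in> B} | i B. enat i < t \<and> B \<in> sets M}"

definition sequential_test :: "'a measure \<Rightarrow> ((nat \<Rightarrow> 'a) \<Rightarrow> enat) \<Rightarrow> bool" where
  "sequential_test M \<tau> \<longleftrightarrow>
     stopping_time (coord_filtration M) \<tau> \<and> (\<forall>\<omega>\<in>space (iid_seq M). 1 \<le> \<tau> \<omega>)"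

definition rejection_prob :: "((nat \<Rightarrow> 'a) \<Rightarrow> enat) \<Rightarrow> 'a measure \<Rightarrow> real" where
  "rejection_prob \<tau> R = measure (iid_seq R) {\<omega> \<in> space (iid_seq R). \<tau> \<omega> < \<infinity>}"

definition level_test :: "real \<Rightarrow> 'a measure set \<Rightarrow> ((nat \<Rightarrow> 'a) \<Rightarrow> enat) \<Rightarrow> bool" where
  "level_test \<alpha> \<P> \<tau> \<longleftrightarrow> (\<forall>P\<in>\<P>. rejection_prob \<tau> P \<le> \<alpha>)"

definition power_one :: "'a measure \<Rightarrow> ((nat \<Rightarrow> 'a) \<Rightarrow> enat) \<Rightarrow> bool" where
  "power_one Q \<tau> \<longleftrightarrow> rejection_prob \<tau> Q = 1"

definition sequentially_testable ::
    "'a measure \<Rightarrow> 'a measure set \<Rightarrow> 'a measure set \<Rightarrow> bool" where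
  "sequentially_testable M \<P> \<Q> \<longleftrightarrow>
     (\<exists>\<alpha>::real. 0 < \<alpha> \<and> \<alpha> < 1 \<and>
        (\<exists>\<tau>. sequential_test M \<tau> \<and> level_test \<alpha> \<P> \<tau> \<and> (\<forall>Q\<in>\<Q>. power_one Q \<tau>)))"

section \<open>Bounded finitely additive measures as functionals\<close>

text \<open>
  A function on the carrier \<open>space N\<close> is represented by its extension by 0, which makes the
  representation unique and keeps it closed under the pointwise vector space operations.
\<close>

definition bdd_meas :: "'b measure \<Rightarrow> ('b \<Rightarrow> real) set" where
  "bdd_meas N = {f \<in> borel_measurable N. bounded (f ` space N) \<and> (\<forall>x. x \<notin> space N \<longrightarrow> f x = 0)}"

definition sup_norm :: "'b measure \<Rightarrow> ('b \<Rightarrow> real) \<Rightarrow> real" where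
  "sup_norm N f = (SUP x\<in>space N. \<bar>f x\<bar>)"

definition ba :: "'b measure \<Rightarrow> (('b \<Rightarrow> real) \<Rightarrow> real) set" where
  "ba N = {\<mu> \<in> extensional (bdd_meas N).
     (\<forall>f\<in>bdd_meas N. \<forall>g\<in>bdd_meas N. \<mu> (\<lambda>x. f x + g x) = \<mu> f + \<mu> g) \<and>
     (\<forall>c. \<forall>f\<in>bdd_meas N. \<mu> (\<lambda>x. c * f x) = c * \<mu> f) \<and>
     (\<exists>K. \<forall>f\<in>bdd_meas N. \<bar>\<mu> f\<bar> \<le> K * sup_norm N f)}"

text \<open>
  The coarsest topology on \<open>ba N\<close> making all evaluations at elements of \<open>bdd_meas N\<close> continuous.
\<close>

definition weak_star :: "'b measure \<Rightarrow> (('b \<Rightarrow> real) \<Rightarrow> real) topology" where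
  "weak_star N = subtopology (product_topology (\<lambda>f. euclideanreal) (bdd_meas N)) (ba N)"

definition ba_of :: "'b measure \<Rightarrow> 'b measure \<Rightarrow> ('b \<Rightarrow> real) \<Rightarrow> real" where
  "ba_of N R = (\<lambda>f\<in>bdd_meas N. \<integral>x. f x \<partial>R)"

definition ba_convex_hull ::
    "'b measure \<Rightarrow> (('b \<Rightarrow> real) \<Rightarrow> real) set \<Rightarrow> (('b \<Rightarrow> real) \<Rightarrow> real) set" where
  "ba_convex_hull N S =
     {\<lambda>f\<in>bdd_meas N. \<Sum>\<mu>\<in>F. c \<mu> * \<mu> f | F c.
        finite F \<and> F \<subseteq> S \<and> (\<forall>\<mu>\<in>F. 0 \<le> c \<mu>) \<and> sum c F = (1::real)}"

text \<open>
  \<open>weak_star_hull M n \<P>\<close> is \<open>\<C>\<^sub>n\<close>, and \<open>weak_star_hull M n \<A>\<close> is \<open>\<D>\<^sub>n(\<A>)\<close>.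
\<close>

definition weak_star_hull ::
    "'a measure \<Rightarrow> nat \<Rightarrow> 'a measure set \<Rightarrow> (((nat \<Rightarrow> 'a) \<Rightarrow> real) \<Rightarrow> real) set" where
  "weak_star_hull M n \<R> =
     weak_star (iid_prod n M) closure_of
       ba_convex_hull (iid_prod n M) ((\<lambda>R. ba_of (iid_prod n M) (iid_prod n R)) ` \<R>)"

definition d_TV ::
    "'b measure \<Rightarrow> (('b \<Rightarrow> real) \<Rightarrow> real) \<Rightarrow> (('b \<Rightarrow> real) \<Rightarrow> real) \<Rightarrow> real" where
  "d_TV N \<mu> \<nu> = (SUP f\<in>{f \<in> bdd_meas N. \<forall>x\<in>space N. 0 \<le> f x \<and> f x \<le> 1}. \<mu> f - \<nu> f)"

definition d_TV_set ::
    "'b measure \<Rightarrow> (('b \<Rightarrow> real) \<Rightarrow> real) set \<Rightarrow> (('b \<Rightarrow> real) \<Rightarrow> real) set \<Rightarrow> real" where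
  "d_TV_set N C D = (INF (\<mu>, \<nu>)\<in>C \<times> D. d_TV N \<mu> \<nu>)"

end

theory Submission
  imports Defs
begin

text \<open>
  The distance between the two weak-* closed hulls is positive iff a single test function on
  \<open>X\<^sup>n\<close> separates the two families of product laws uniformly: the hulls are weak-*
  compact, so finitely many test functions already witness that all pairs are apart, and a minimax
  argument on finitely many functions merges them into one.

  Given a test with level \<open>\<alpha> < 1\<close>, the indicator of \<open>\<tau> > n\<close> separates the null
  hypotheses from those alternatives that reject by time \<open>n\<close> with probability more than
  \<open>(1 + \<alpha>) / 2\<close>. Conversely, averaging a separating function over disjoint blocks gives, by
  Hoeffding's inequality, events \<open>E m j\<close> depending on finitely many observations whose null
  probabilities are summable with sum at most 1/2 and whose probabilities under the \<open>m\<close>-th family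
  tend to 1 with \<open>j\<close>; the test stops as soon as one of them has occurred.
\<close>

section \<open>A minimax theorem for finitely many functions\<close>

lemma two_function_alternative:
  fixes a b :: "'z \<Rightarrow> real"
  assumes conv: "\<And>z w s. z \<in> Z \<Longrightarrow> w \<in> Z \<Longrightarrow> 0 \<le> s \<Longrightarrow> s \<le> 1 \<Longrightarrow>
      \<exists>y\<in>Z. a y \<le> s * a z + (1 - s) * a w \<and> b y \<le> s * b z + (1 - s) * b w"
    and ge: "\<And>z. z \<in> Z \<Longrightarrow> \<eta> \<le> a z \<or> \<eta> \<le> b z" and "0 < \<eta>"
  obtains t where "0 \<le> t" "t \<le> 1" "\<And>z. z \<in> Z \<Longrightarrow> 0 \<le> t * a z + (1 - t) * b z"
proof -
  \<comment> \<open>Points with \<open>b z < 0\<close> bound \<open>t\<close> from below and points with \<open>a z < 0\<close> from above; two clashing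
    bounds would give a convex combination at which both functions are below \<open>\<eta>\<close>.\<close>
  define L where "L = insert 0 {- b z / (a z - b z) |z. z \<in> Z \<and> b z < 0}"
  have a_ge: "\<eta> \<le> a z" if "z \<in> Z" "b z < 0" for z
    using ge[OF that(1)] that \<open>0 < \<eta>\<close> by auto
  have b_ge: "\<eta> \<le> b z" if "z \<in> Z" "a z < 0" for z
    using ge[OF that(1)] that \<open>0 < \<eta>\<close> by auto
  have L_le_1: "l \<le> 1" if l: "l \<in> L" for l
    using l a_ge \<open>0 < \<eta>\<close> unfolding L_def by (fastforce simp: divide_simps)
  then have bdd: "bdd_above L" by (auto simp: bdd_above_def)
  have L_le: "l \<le> b w / (b w - a w)" if l: "l \<in> L" and w: "w \<in> Z" "a w < 0" for l w
  proof (cases "l = 0")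
    case True
    then show ?thesis using b_ge[OF w] w \<open>0 < \<eta>\<close> by (simp add: divide_simps)
  next
    case False
    then obtain z where z: "z \<in> Z" "b z < 0" and l: "l = - b z / (a z - b z)"
      using l by (auto simp: L_def)
    have az: "\<eta> \<le> a z" and bw: "\<eta> \<le> b w" using a_ge[OF z] b_ge[OF w] by auto
    \<comment> \<open>The weight at which \<open>s * a z + (1 - s) * a w\<close> vanishes. The point
      \<open>y\<close> then has \<open>a y\<close> at most 0, so the alternative forces
      \<open>b y\<close> to be at least \<open>\<eta>\<close>.\<close>
    define s where "s = - a w / (a z - a w)"
    have d: "a z - a w > 0" using az w \<open>0 < \<eta>\<close> by auto
    have s: "0 \<le> s" "s \<le> 1" using d w az \<open>0 < \<eta>\<close> by (auto simp: s_def divide_simps)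
    obtain y where y: "y \<in> Z" "a y \<le> s * a z + (1 - s) * a w" "b y \<le> s * b z + (1 - s) * b w"
      using conv[OF z(1) w(1) s] by blast
    have 1: "1 - s = a z / (a z - a w)" using d by (simp add: s_def field_simps)
    have "a y \<le> 0" using y(2) unfolding 1 unfolding s_def by (simp add: field_simps)
    then have "\<eta> \<le> b y" using ge[OF y(1)] \<open>0 < \<eta>\<close> by auto
    then have "0 < (- a w / (a z - a w)) * b z + (a z / (a z - a w)) * b w"
      using y(3) \<open>0 < \<eta>\<close> unfolding 1 unfolding s_def by linarith
    also have "\<dots> = (a z * b w - a w * b z) / (a z - a w)"
      by (simp add: diff_divide_distrib)
    \<comment> \<open>After clearing denominators, this says that the lower bound from
      \<open>z\<close> does not exceed the upper bound from \<open>w\<close>.\<close>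
    finally have "a z * b w - a w * b z > 0" using d by (simp add: zero_less_divide_iff)
    then have "- b z * (b w - a w) \<le> b w * (a z - b z)" by (simp add: algebra_simps)
    moreover have "0 < b w - a w" "0 < a z - b z" using az bw z w \<open>0 < \<eta>\<close> by auto
    ultimately show ?thesis unfolding l by (simp only: frac_le_eq divide_le_eq) (simp add: field_simps)
  qed
  \<comment> \<open>The supremum meets every lower bound, and by \<open>L_le\<close> it respects
    every upper bound.\<close>
  define t where "t = Sup L"
  show thesis
  proof
    show "0 \<le> t" unfolding t_def by (rule cSup_upper[OF _ bdd]) (simp add: L_def)
    show "t \<le> 1" unfolding t_def by (rule cSup_least) (use L_le_1 in \<open>auto simp: L_def\<close>)
    fix z assume z: "z \<in> Z"
    consider "b z < 0" | "a z < 0" | "0 \<le> a z" "0 \<le> b z" by linarith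
    then show "0 \<le> t * a z + (1 - t) * b z"
    proof cases
      case 1
      have "- b z / (a z - b z) \<le> t"
        unfolding t_def by (rule cSup_upper[OF _ bdd]) (use 1 z in \<open>auto simp: L_def\<close>)
      then show ?thesis using a_ge[OF z 1] 1 \<open>0 < \<eta>\<close> by (simp add: field_simps)
    next
      case 2
      have "t \<le> b z / (b z - a z)"
        unfolding t_def by (rule cSup_least) (use L_le z 2 in \<open>auto simp: L_def\<close>)
      then show ?thesis using b_ge[OF z 2] 2 \<open>0 < \<eta>\<close> by (simp add: field_simps)
    next
      case 3
      then show ?thesis using \<open>0 \<le> t\<close> \<open>t \<le> 1\<close> by (intro add_nonneg_nonneg mult_nonneg_nonneg) auto
    qed
  qed
qed

text \<open>
  The alternative \<open>\<epsilon> \<le> \<Phi> f z\<close> for some \<open>f\<close> in the finite set is stable under passing to the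
  sublevel set of one \<open>f\<close>, so an induction removes the functions one at a time. Each step
  loses a part of the gap \<open>\<epsilon> - \<epsilon>'\<close> because the two-function case needs a strict margin.
\<close>

lemma finite_minimax:
  fixes \<Phi> :: "'f \<Rightarrow> 'z \<Rightarrow> real"
  assumes "finite F" "F \<noteq> {}" "F \<subseteq> G" "\<epsilon>' < \<epsilon>"
    and concave: "\<And>f g t. f \<in> G \<Longrightarrow> g \<in> G \<Longrightarrow> 0 \<le> t \<Longrightarrow> t \<le> 1 \<Longrightarrow>
      \<exists>h\<in>G. \<forall>z\<in>Z. t * \<Phi> f z + (1 - t) * \<Phi> g z \<le> \<Phi> h z"
    and convex: "\<And>z w s. z \<in> Z \<Longrightarrow> w \<in> Z \<Longrightarrow> 0 \<le> s \<Longrightarrow> s \<le> 1 \<Longrightarrow>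
      \<exists>y\<in>Z. \<forall>f\<in>G. \<Phi> f y \<le> s * \<Phi> f z + (1 - s) * \<Phi> f w"
    and ge: "\<And>z. z \<in> Z \<Longrightarrow> \<exists>f\<in>F. \<epsilon> \<le> \<Phi> f z"
  shows "\<exists>g\<in>G. \<forall>z\<in>Z. \<epsilon>' \<le> \<Phi> g z"
  using assms
proof (induction F arbitrary: Z \<epsilon>' \<epsilon> rule: finite_ne_induct)
  case (singleton f)
  then show ?case by (force intro: bexI[of _ f])
next
  case (insert f F)
  define e where "e = (\<epsilon>' + \<epsilon>) / 2"
  have e: "\<epsilon>' < e" "e < \<epsilon>" using insert.prems(2) by (auto simp: e_def)
  \<comment> \<open>Off \<open>Z'\<close> the function \<open>f\<close> already reaches
    \<open>\<epsilon>\<close>, so the remaining functions only have to work on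
    \<open>Z'\<close>.\<close>
  define Z' where "Z' = {z \<in> Z. \<Phi> f z < \<epsilon>}"
  have fG: "f \<in> G" using insert.prems by auto
  have "\<exists>g\<in>G. \<forall>z\<in>Z'. e \<le> \<Phi> g z"
  proof (rule insert.IH[OF _ e(2)])
    show "F \<subseteq> G" using insert.prems by auto
    fix f' g t assume "f' \<in> G" "g \<in> G" "0 \<le> t" "t \<le> (1::real)"
    from insert.prems(3)[OF this]
    show "\<exists>h\<in>G. \<forall>z\<in>Z'. t * \<Phi> f' z + (1 - t) * \<Phi> g z \<le> \<Phi> h z"
      by (auto simp: Z'_def)
  next
    fix z w s assume zw: "z \<in> Z'" "w \<in> Z'" and s: "0 \<le> s" "s \<le> (1::real)"
    then obtain y where y: "y \<in> Z" "\<forall>f\<in>G. \<Phi> f y \<le> s * \<Phi> f z + (1 - s) * \<Phi> f w"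
      using insert.prems(4)[of z w s] by (auto simp: Z'_def)
    \<comment> \<open>The point \<open>y\<close> given by convexity stays in the sublevel set, so
      the hypothesis on \<open>Z\<close> is inherited by \<open>Z'\<close>.\<close>
    have "s * \<Phi> f z + (1 - s) * \<Phi> f w < \<epsilon>"
      using zw s by (intro convex_bound_lt) (auto simp: Z'_def)
    then show "\<exists>y\<in>Z'. \<forall>f\<in>G. \<Phi> f y \<le> s * \<Phi> f z + (1 - s) * \<Phi> f w"
      using y fG by (force simp: Z'_def)
  next
    fix z assume "z \<in> Z'"
    then show "\<exists>f\<in>F. \<epsilon> \<le> \<Phi> f z"
      using insert.prems(5)[of z] by (auto simp: Z'_def)
  qed
  then obtain g where g: "g \<in> G" "\<And>z. z \<in> Z' \<Longrightarrow> e \<le> \<Phi> g z" by blast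
  \<comment> \<open>On \<open>Z'\<close> the function \<open>g\<close> is at least \<open>e\<close>,
    elsewhere \<open>f\<close> is. After subtracting \<open>\<epsilon>'\<close> the margin
    \<open>e - \<epsilon>'\<close> is positive, as the two-function case demands.\<close>
  obtain t where t: "0 \<le> t" "t \<le> 1"
    "\<And>z. z \<in> Z \<Longrightarrow> 0 \<le> t * (\<Phi> f z - \<epsilon>') + (1 - t) * (\<Phi> g z - \<epsilon>')"
  proof (rule two_function_alternative[of Z "\<lambda>z. \<Phi> f z - \<epsilon>'" "\<lambda>z. \<Phi> g z - \<epsilon>'" "e - \<epsilon>'"])
    fix z w s assume zw: "z \<in> Z" "w \<in> Z" and s: "0 \<le> s" "s \<le> (1::real)"
    from insert.prems(4)[OF this] fG g(1)
    show "\<exists>y\<in>Z. \<Phi> f y - \<epsilon>' \<le> s * (\<Phi> f z - \<epsilon>') + (1 - s) * (\<Phi> f w - \<epsilon>') \<and>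
         \<Phi> g y - \<epsilon>' \<le> s * (\<Phi> g z - \<epsilon>') + (1 - s) * (\<Phi> g w - \<epsilon>')"
      by (simp add: algebra_simps) blast
  next
    fix z assume "z \<in> Z"
    then show "e - \<epsilon>' \<le> \<Phi> f z - \<epsilon>' \<or> e - \<epsilon>' \<le> \<Phi> g z - \<epsilon>'"
      using g(2)[of z] e by (cases "\<Phi> f z < \<epsilon>") (auto simp: Z'_def)
  qed (use e in auto)
  obtain h where h: "h \<in> G" "\<forall>z\<in>Z. t * \<Phi> f z + (1 - t) * \<Phi> g z \<le> \<Phi> h z"
    using insert.prems(3)[OF fG g(1) t(1,2)] by blast
  have "\<epsilon>' \<le> \<Phi> h z" if "z \<in> Z" for z
    using t(3)[OF that] h(2) that by (auto simp: algebra_simps)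
  then show ?case using h(1) by blast
qed

section \<open>Separation of weak-* closed hulls\<close>

text \<open>The index set of the supremum in \<open>d_TV\<close>.\<close>

abbreviation test_functions :: "'b measure \<Rightarrow> ('b \<Rightarrow> real) set" where
  "test_functions N \<equiv> {f \<in> bdd_meas N. \<forall>x\<in>space N. 0 \<le> f x \<and> f x \<le> 1}"

lemma bdd_meas_add: "f \<in> bdd_meas N \<Longrightarrow> g \<in> bdd_meas N \<Longrightarrow> (\<lambda>x. f x + g x) \<in> bdd_meas N"
  by (auto simp: bdd_meas_def intro!: bounded_plus_comp)

lemma bdd_meas_scale: "f \<in> bdd_meas N \<Longrightarrow> (\<lambda>x. c * f x) \<in> bdd_meas N"
  by (auto simp: bdd_meas_def image_image intro!: bounded_scaling[of "f ` space N" c, unfolded image_image real_scaleR_def])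

lemma test_functionsI:
  assumes "f \<in> borel_measurable N" "\<And>x. x \<in> space N \<Longrightarrow> 0 \<le> f x \<and> f x \<le> 1"
    "\<And>x. x \<notin> space N \<Longrightarrow> f x = 0"
  shows "f \<in> test_functions N"
  using assms by (auto simp: bdd_meas_def intro!: boundedI[of _ 1])

lemma test_functions_convex:
  assumes "f \<in> test_functions N" "g \<in> test_functions N" "0 \<le> t" "t \<le> 1"
  shows "(\<lambda>x. t * f x + (1 - t) * g x) \<in> test_functions N"
  using assms convex_bound_le[of "f _" 1 "g _" t "1 - t"]
  by (simp add: bdd_meas_add bdd_meas_scale)

lemma abs_le_sup_norm:
  assumes "f \<in> bdd_meas N" "x \<in> space N"
  shows "\<bar>f x\<bar> \<le> sup_norm N f"
proof -
  have "bdd_above ((\<lambda>x. \<bar>f x\<bar>) ` space N)"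
    using assms(1) by (auto simp: bdd_meas_def bounded_iff bdd_above_def)
  then show ?thesis unfolding sup_norm_def by (rule cSUP_upper[OF assms(2)])
qed

lemma sup_norm_test_function:
  assumes "f \<in> test_functions N" "space N \<noteq> {}"
  shows "0 \<le> sup_norm N f" "sup_norm N f \<le> 1"
proof -
  show "0 \<le> sup_norm N f" using assms abs_le_sup_norm[of f N] by fastforce
  show "sup_norm N f \<le> 1" unfolding sup_norm_def by (rule cSUP_least) (use assms in auto)
qed

lemma integrable_bdd_meas:
  assumes "f \<in> bdd_meas N" "R \<in> space (prob_algebra N)"
  shows "integrable R f"
proof -
  interpret prob_space R using assms(2) by (simp add: space_prob_algebra)
  have s: "sets R = sets N" using assms(2) by (simp add: space_prob_algebra)
  show ?thesis
  proof (rule integrable_const_bound[where B = "sup_norm N f"])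
    show "AE x in R. norm (f x) \<le> sup_norm N f"
      using abs_le_sup_norm[OF assms(1)] sets_eq_imp_space_eq[OF s] by (intro AE_I2) auto
    show "f \<in> borel_measurable R" using assms(1) by (simp add: bdd_meas_def measurable_cong_sets[OF s])
  qed
qed

text \<open>
  A weak-* compact convex set containing every finitely additive probability; membership
  replaces normalisation and positivity in all later arguments.
\<close>

definition dominated :: "'b measure \<Rightarrow> (('b \<Rightarrow> real) \<Rightarrow> real) set" where
  "dominated N = {\<mu> \<in> ba N. \<forall>f\<in>bdd_meas N. \<bar>\<mu> f\<bar> \<le> sup_norm N f}"

section \<open>Weak-star closed conditions and compactness of the dual unit ball\<close>

lemma closedin_Collect_ball:
  assumes "\<And>i. i \<in> I \<Longrightarrow> closedin X {x \<in> topspace X. P i x}"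
  shows "closedin X {x \<in> topspace X. \<forall>i\<in>I. P i x}"
proof -
  \<comment> \<open>The factor \<open>topspace X\<close> takes care of empty \<open>I\<close>, where
    the intersection alone would be the whole type.\<close>
  have "{x \<in> topspace X. \<forall>i\<in>I. P i x} = topspace X \<inter> (\<Inter>i\<in>I. {x \<in> topspace X. P i x})" by auto
  moreover have "closedin X \<dots>"
    using assms by (cases "I = {}") (simp, blast intro: closedin_Int)
  ultimately show ?thesis by simp
qed

lemma closedin_Collect_real_eq:
  assumes "continuous_map X euclideanreal f" "continuous_map X euclideanreal g"
  shows "closedin X {x \<in> topspace X. f x = g x}"
  using closedin_continuous_map_preimage[OF continuous_map_diff[OF assms], of "{0}"] by simp

lemma closedin_Collect_real_le:
  assumes "continuous_map X euclideanreal f" "continuous_map X euclideanreal g"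
  shows "closedin X {x \<in> topspace X. f x \<le> g x}"
  using closedin_continuous_map_preimage[OF continuous_map_diff[OF assms], of "{..0}"] by simp

lemma continuous_map_weak_star_eval:
  "f \<in> bdd_meas N \<Longrightarrow> continuous_map (weak_star N) euclideanreal (\<lambda>\<mu>. \<mu> f)"
  unfolding weak_star_def
  by (intro continuous_map_from_subtopology) (rule continuous_map_product_projection)

lemma topspace_weak_star: "topspace (weak_star N) = ba N"
  by (auto simp: weak_star_def ba_def PiE_def)

text \<open>The Banach-Alaoglu argument: linearity and the norm bound are closed conditions on
  evaluations, and they cut a closed subset out of a product of compact intervals.\<close>

lemma compactin_dominated: "compactin (weak_star N) (dominated N)"
proof -
  define B where "B = bdd_meas N"
  define X where "X = product_topology (\<lambda>f::'a \<Rightarrow> real. euclideanreal) B"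
  have top: "topspace X = extensional B" by (simp add: X_def PiE_def)
  have ev: "continuous_map X euclideanreal (\<lambda>\<mu>. \<mu> f)" if "f \<in> B" for f
    unfolding X_def by (rule continuous_map_product_projection[OF that])
  \<comment> \<open>The description takes place in the full product of lines rather than in
    \<open>ba N\<close>. The boundedness clause of \<open>ba N\<close> follows with constant
    1.\<close>
  have eq: "dominated N =
      {\<mu> \<in> topspace X. \<forall>f\<in>B. \<forall>g\<in>B. \<mu> (\<lambda>x. f x + g x) = \<mu> f + \<mu> g} \<inter>
      {\<mu> \<in> topspace X. \<forall>c\<in>UNIV. \<forall>f\<in>B. \<mu> (\<lambda>x. c * f x) = c * \<mu> f} \<inter>
      {\<mu> \<in> topspace X. \<forall>f\<in>B. \<bar>\<mu> f\<bar> \<le> sup_norm N f}" (is "_ = ?A1 \<inter> ?A2 \<inter> ?A3")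
  proof (intro set_eqI iffI)
    fix \<mu> assume "\<mu> \<in> dominated N"
    then show "\<mu> \<in> ?A1 \<inter> ?A2 \<inter> ?A3"
      unfolding dominated_def ba_def top B_def by simp
  next
    fix \<mu> assume "\<mu> \<in> ?A1 \<inter> ?A2 \<inter> ?A3"
    then show "\<mu> \<in> dominated N"
      unfolding dominated_def ba_def top B_def by (simp add: exI[of _ "1::real"])
  qed
  have closed: "closedin X (dominated N)"
    unfolding eq
    by (intro closedin_Int closedin_Collect_ball closedin_Collect_real_eq closedin_Collect_real_le
          continuous_map_add continuous_map_real_mult_left continuous_map_real_abs ev)
      (auto simp: B_def bdd_meas_add bdd_meas_scale)
  \<comment> \<open>Tychonoff's theorem for the intervals prescribed by the supremum norm.\<close>
  have "compactin X (PiE B (\<lambda>f. {- sup_norm N f..sup_norm N f}))"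
    unfolding X_def by (subst compactin_PiE) auto
  moreover have "dominated N \<subseteq> PiE B (\<lambda>f. {- sup_norm N f..sup_norm N f})"
    unfolding eq top
    by (rule subsetI) (simp add: PiE_iff abs_le_iff minus_le_iff[of "sup_norm N _"])
  ultimately have "compactin X (dominated N)" using closed by (metis closed_compactin)
  then show ?thesis
    unfolding weak_star_def compactin_subtopology X_def B_def by (auto simp: dominated_def)
qed

lemma ba_of_in_dominated:
  assumes R: "R \<in> space (prob_algebra N)"
  shows "ba_of N R \<in> dominated N"
proof -
  interpret prob_space R using R by (simp add: space_prob_algebra)
  have sp: "space R = space N" using R by (auto simp: space_prob_algebra dest: sets_eq_imp_space_eq)
  have "\<bar>\<integral>x. f x \<partial>R\<bar> \<le> sup_norm N f" if f: "f \<in> bdd_meas N" for f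
  proof -
    note [simp] = integrable_bdd_meas[OF f R]
    have "\<bar>\<integral>x. f x \<partial>R\<bar> \<le> (\<integral>x. \<bar>f x\<bar> \<partial>R)" by (rule integral_abs_bound)
    also have "\<dots> \<le> (\<integral>x. sup_norm N f \<partial>R)"
      by (rule integral_mono) (use abs_le_sup_norm[OF f] sp in auto)
    finally show ?thesis by (simp add: prob_space)
  qed
  then show ?thesis
    unfolding dominated_def ba_def ba_of_def
    by (simp add: bdd_meas_add bdd_meas_scale integrable_bdd_meas[OF _ R] exI[of _ "1::real"])
qed

section \<open>Convex hulls of functionals\<close>

lemma hull_in_dominated:
  assumes "S \<subseteq> dominated N"
  shows "ba_convex_hull N S \<subseteq> dominated N"
proof
  fix \<mu> assume "\<mu> \<in> ba_convex_hull N S"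
  then obtain F c where \<mu>: "\<mu> = (\<lambda>f\<in>bdd_meas N. \<Sum>\<nu>\<in>F. c \<nu> * \<nu> f)"
    and F: "finite F" "F \<subseteq> S" "\<forall>\<nu>\<in>F. 0 \<le> c \<nu>" "sum c F = (1::real)"
    by (auto simp: ba_convex_hull_def)
  have dom: "\<nu> \<in> dominated N" if "\<nu> \<in> F" for \<nu> using that F assms by auto
  have "\<bar>\<Sum>\<nu>\<in>F. c \<nu> * \<nu> f\<bar> \<le> sup_norm N f" if f: "f \<in> bdd_meas N" for f
  proof -
    have "\<bar>\<Sum>\<nu>\<in>F. c \<nu> * \<nu> f\<bar> \<le> (\<Sum>\<nu>\<in>F. c \<nu> * sup_norm N f)"
      using F(3) dom f by (intro sum_abs[THEN order_trans] sum_mono)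
        (auto simp: abs_mult dominated_def intro!: mult_left_mono)
    then show ?thesis using F(4) by (simp flip: sum_distrib_right)
  qed
  moreover have "(\<Sum>\<nu>\<in>F. c \<nu> * \<nu> (\<lambda>x. f x + g x)) = (\<Sum>\<nu>\<in>F. c \<nu> * \<nu> f) + (\<Sum>\<nu>\<in>F. c \<nu> * \<nu> g)"
    if "f \<in> bdd_meas N" "g \<in> bdd_meas N" for f g
    unfolding sum.distrib[symmetric]
  proof (rule sum.cong[OF refl])
    fix \<nu> assume "\<nu> \<in> F"
    then have "\<nu> (\<lambda>x. f x + g x) = \<nu> f + \<nu> g" using dom that by (auto simp: dominated_def ba_def)
    then show "c \<nu> * \<nu> (\<lambda>x. f x + g x) = c \<nu> * \<nu> f + c \<nu> * \<nu> g" by (simp only: distrib_left)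
  qed
  moreover have "(\<Sum>\<nu>\<in>F. c \<nu> * \<nu> (\<lambda>x. k * f x)) = k * (\<Sum>\<nu>\<in>F. c \<nu> * \<nu> f)"
    if "f \<in> bdd_meas N" for f k
    unfolding sum_distrib_left
  proof (rule sum.cong[OF refl])
    fix \<nu> assume "\<nu> \<in> F"
    then have "\<nu> (\<lambda>x. k * f x) = k * \<nu> f" using dom that by (auto simp: dominated_def ba_def)
    then show "c \<nu> * \<nu> (\<lambda>x. k * f x) = k * (c \<nu> * \<nu> f)" by (simp only: mult.left_commute)
  qed
  ultimately show "\<mu> \<in> dominated N"
    unfolding dominated_def ba_def \<mu>
    by (simp add: bdd_meas_add bdd_meas_scale exI[of _ "1::real"])
qed

text \<open>Elements of the hull are restricted to \<open>bdd_meas N\<close>, so the trivial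
  combination of \<open>\<mu>\<close> returns \<open>\<mu>\<close> only when \<open>\<mu>\<close> is
  extensional.\<close>

lemma hull_inc:
  assumes "\<mu> \<in> S" "\<mu> \<in> extensional (bdd_meas N)"
  shows "\<mu> \<in> ba_convex_hull N S"
proof -
  have "\<mu> = (\<lambda>f\<in>bdd_meas N. \<Sum>\<nu>\<in>{\<mu>}. 1 * \<nu> f)"
    using assms(2) by (auto simp: extensional_def restrict_def fun_eq_iff)
  then show ?thesis using assms(1) unfolding ba_convex_hull_def
    by (intro CollectI exI[of _ "{\<mu>}"] exI[of _ "\<lambda>_. 1"]) auto
qed

lemma hull_convex:
  assumes "\<mu> \<in> ba_convex_hull N S" "\<nu> \<in> ba_convex_hull N S" "0 \<le> s" "s \<le> 1"
  shows "(\<lambda>f\<in>bdd_meas N. s * \<mu> f + (1 - s) * \<nu> f) \<in> ba_convex_hull N S"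
proof -
  obtain F c where \<mu>: "\<mu> = (\<lambda>f\<in>bdd_meas N. \<Sum>\<kappa>\<in>F. c \<kappa> * \<kappa> f)"
    and F: "finite F" "F \<subseteq> S" "\<forall>\<kappa>\<in>F. 0 \<le> c \<kappa>" "sum c F = (1::real)"
    using assms(1) by (auto simp: ba_convex_hull_def)
  obtain G d where \<nu>: "\<nu> = (\<lambda>f\<in>bdd_meas N. \<Sum>\<kappa>\<in>G. d \<kappa> * \<kappa> f)"
    and G: "finite G" "G \<subseteq> S" "\<forall>\<kappa>\<in>G. 0 \<le> d \<kappa>" "sum d G = (1::real)"
    using assms(2) by (auto simp: ba_convex_hull_def)
  \<comment> \<open>Both coefficient families are extended by 0 to the union of their supports; a
    functional in both supports receives both contributions.\<close>
  define e where "e \<kappa> = s * (if \<kappa> \<in> F then c \<kappa> else 0) + (1 - s) * (if \<kappa> \<in> G then d \<kappa> else 0)" for \<kappa>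
  have sum_e: "(\<Sum>\<kappa>\<in>F \<union> G. e \<kappa> * h \<kappa>) = s * (\<Sum>\<kappa>\<in>F. c \<kappa> * h \<kappa>) + (1 - s) * (\<Sum>\<kappa>\<in>G. d \<kappa> * h \<kappa>)"
    for h :: "(('a \<Rightarrow> real) \<Rightarrow> real) \<Rightarrow> real"
  proof -
    have "(\<Sum>\<kappa>\<in>F. c \<kappa> * h \<kappa>) = (\<Sum>\<kappa>\<in>F \<union> G. (if \<kappa> \<in> F then c \<kappa> else 0) * h \<kappa>)"
      using F(1) G(1) by (intro sum.mono_neutral_cong_left) auto
    moreover have "(\<Sum>\<kappa>\<in>G. d \<kappa> * h \<kappa>) = (\<Sum>\<kappa>\<in>F \<union> G. (if \<kappa> \<in> G then d \<kappa> else 0) * h \<kappa>)"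
      using F(1) G(1) by (intro sum.mono_neutral_cong_left) auto
    ultimately show ?thesis
      unfolding e_def by (simp only: distrib_right sum.distrib sum_distrib_left mult.assoc)
  qed
  show ?thesis
    unfolding ba_convex_hull_def
  proof (intro CollectI exI conjI)
    show "(\<lambda>f\<in>bdd_meas N. s * \<mu> f + (1 - s) * \<nu> f) = (\<lambda>f\<in>bdd_meas N. \<Sum>\<kappa>\<in>F \<union> G. e \<kappa> * \<kappa> f)"
      unfolding \<mu> \<nu> by (rule restrict_ext) (simp only: sum_e restrict_apply')
    show "\<forall>\<kappa>\<in>F \<union> G. 0 \<le> e \<kappa>" using F(3) G(3) assms(3,4) by (auto simp: e_def)
    show "sum e (F \<union> G) = 1" using sum_e[of "\<lambda>_. 1"] F(4) G(4) by simp
  qed (use F G in auto)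
qed

text \<open>Evaluation at \<open>f\<close> is affine, so half-spaces containing the generators
  contain the hull. This and the reverse bound carry a separating function from the laws to the
  hulls.\<close>

lemma hull_eval_le:
  assumes "\<And>\<nu>. \<nu> \<in> S \<Longrightarrow> \<nu> f \<le> (u::real)" "f \<in> bdd_meas N" "\<mu> \<in> ba_convex_hull N S"
  shows "\<mu> f \<le> u"
proof -
  obtain F c where \<mu>: "\<mu> = (\<lambda>f\<in>bdd_meas N. \<Sum>\<kappa>\<in>F. c \<kappa> * \<kappa> f)"
    and F: "finite F" "F \<subseteq> S" "\<forall>\<kappa>\<in>F. 0 \<le> c \<kappa>" "sum c F = (1::real)"
    using assms(3) by (auto simp: ba_convex_hull_def)
  have "(\<Sum>\<kappa>\<in>F. c \<kappa> * \<kappa> f) \<le> (\<Sum>\<kappa>\<in>F. c \<kappa> * u)"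
    using F assms(1) by (intro sum_mono mult_left_mono) auto
  then show ?thesis using assms(2) F(4) by (simp add: \<mu> flip: sum_distrib_right)
qed

lemma hull_eval_ge:
  assumes "\<And>\<nu>. \<nu> \<in> S \<Longrightarrow> (l::real) \<le> \<nu> f" "f \<in> bdd_meas N" "\<mu> \<in> ba_convex_hull N S"
  shows "l \<le> \<mu> f"
proof -
  obtain F c where \<mu>: "\<mu> = (\<lambda>f\<in>bdd_meas N. \<Sum>\<kappa>\<in>F. c \<kappa> * \<kappa> f)"
    and F: "finite F" "F \<subseteq> S" "\<forall>\<kappa>\<in>F. 0 \<le> c \<kappa>" "sum c F = (1::real)"
    using assms(3) by (auto simp: ba_convex_hull_def)
  have "(\<Sum>\<kappa>\<in>F. c \<kappa> * l) \<le> (\<Sum>\<kappa>\<in>F. c \<kappa> * \<kappa> f)"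
    using F assms(1) by (intro sum_mono mult_left_mono) auto
  then show ?thesis using assms(2) F(4) by (simp add: \<mu> flip: sum_distrib_right)
qed

section \<open>The total variation distance and its positivity\<close>

lemma d_TV_bdd_above:
  assumes "\<mu> \<in> dominated N" "\<nu> \<in> dominated N" "space N \<noteq> {}"
  shows "bdd_above ((\<lambda>f. \<mu> f - \<nu> f) ` test_functions N)"
proof (rule bdd_aboveI2)
  fix f assume f: "f \<in> test_functions N"
  then have "\<bar>\<mu> f\<bar> \<le> sup_norm N f" "\<bar>\<nu> f\<bar> \<le> sup_norm N f"
    using assms by (auto simp: dominated_def)
  \<comment> \<open>Each of the two functionals has absolute value at most 1 on a test
    function.\<close>
  then show "\<mu> f - \<nu> f \<le> 2" using sup_norm_test_function[OF f assms(3)] by linarith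
qed

lemma zero_test_function: "(\<lambda>_. 0) \<in> test_functions N"
  by (rule test_functionsI) auto

text \<open>The zero function is a test function at which both functionals vanish. The bound makes
  the infimum in \<open>d_TV_set\<close> one over a set bounded below.\<close>

lemma d_TV_nonneg:
  assumes "\<mu> \<in> dominated N" "\<nu> \<in> dominated N" "space N \<noteq> {}"
  shows "0 \<le> d_TV N \<mu> \<nu>"
proof -
  have "\<kappa> (\<lambda>_. 0) = 0" if "\<kappa> \<in> dominated N" for \<kappa>
  proof -
    have "\<forall>c. \<forall>f\<in>bdd_meas N. \<kappa> (\<lambda>x. c * f x) = c * \<kappa> f"
      using that by (auto simp: dominated_def ba_def)
    from this[rule_format, of "\<lambda>_. 0" 0] show ?thesis using zero_test_function[of N] by simp
  qed
  from this[OF assms(1)] this[OF assms(2)] show ?thesis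
    using cSUP_upper[OF zero_test_function d_TV_bdd_above[OF assms]] unfolding d_TV_def by linarith
qed

text \<open>Forward, compactness of the closures yields finitely many test functions, and the
  minimax theorem is applied on the hulls themselves, which contain the given laws. Backward, the
  two half-spaces determined by \<open>f\<close> are weak-star closed and contain the hulls, hence
  also \<open>C\<close> and \<open>D\<close>, so every pair is at distance at least
  \<open>\<delta>\<close>.\<close>

lemma d_TV_set_pos_iff:
  fixes N :: "'b measure" and S T :: "'b measure set"
  assumes S: "S \<subseteq> space (prob_algebra N)" "S \<noteq> {}" and T: "T \<subseteq> space (prob_algebra N)" "T \<noteq> {}"
  defines "C \<equiv> weak_star N closure_of ba_convex_hull N (ba_of N ` S)"
    and "D \<equiv> weak_star N closure_of ba_convex_hull N (ba_of N ` T)"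
  shows "0 < d_TV_set N C D \<longleftrightarrow>
    (\<exists>f\<in>test_functions N. \<exists>c. \<exists>\<delta>>0. (\<forall>P\<in>S. c + \<delta> \<le> (\<integral>x. f x \<partial>P)) \<and> (\<forall>Q\<in>T. (\<integral>x. f x \<partial>Q) \<le> c))"
proof -
  let ?W = "weak_star N" and ?H = "ba_convex_hull N"
  let ?ba = "\<lambda>U. ba_of N ` U"
  have sp: "space N \<noteq> {}"
  proof -
    obtain P where "P \<in> S" using S by auto
    then have "prob_space P" "space P = space N"
      using S by (auto simp: space_prob_algebra dest: sets_eq_imp_space_eq)
    then show ?thesis using prob_space.not_empty by force
  qed
  have dom: "?H (?ba U) \<subseteq> dominated N" if "U \<subseteq> space (prob_algebra N)" for U
    using that by (intro hull_in_dominated) (auto intro: ba_of_in_dominated)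
  have closed: "closedin ?W (dominated N)"
  proof -
    have "dominated N = {\<mu> \<in> topspace ?W. \<forall>f\<in>bdd_meas N. \<bar>\<mu> f\<bar> \<le> sup_norm N f}"
      by (auto simp: dominated_def topspace_weak_star)
    also have "closedin ?W \<dots>"
      by (intro closedin_Collect_ball closedin_Collect_real_le continuous_map_real_abs
          continuous_map_weak_star_eval) auto
    finally show ?thesis .
  qed
  have cl_dom: "?W closure_of ?H (?ba U) \<subseteq> dominated N" if "U \<subseteq> space (prob_algebra N)" for U
    by (intro closure_of_minimal dom that closed)
  have CD: "C \<subseteq> dominated N" "D \<subseteq> dominated N" unfolding C_def D_def using S T cl_dom by auto
  have sub: "?H (?ba U) \<subseteq> ?W closure_of ?H (?ba U)" if "U \<subseteq> space (prob_algebra N)" for U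
    using dom[OF that] by (intro closure_of_subset) (auto simp: topspace_weak_star dominated_def)
  have inc: "ba_of N R \<in> ?H (?ba U)" if "R \<in> U" "U \<subseteq> space (prob_algebra N)" for R U
    using that by (intro hull_inc) (auto simp: ba_of_def)
  have ne: "C \<noteq> {}" "D \<noteq> {}" unfolding C_def D_def using S T inc sub by blast+
  have bdd: "bdd_below ((\<lambda>(\<mu>, \<nu>). d_TV N \<mu> \<nu>) ` (C \<times> D))"
    using d_TV_nonneg[OF _ _ sp] CD by (intro bdd_belowI[of _ 0]) fastforce
  show ?thesis
  proof
    assume pos: "0 < d_TV_set N C D"
    define d where "d = d_TV_set N C D"
    \<comment> \<open>The pairs which \<open>f\<close> fails to separate by more than half the
      distance.\<close>
    define K where "K f = {p \<in> topspace (prod_topology ?W ?W). fst p f - snd p f \<le> d / 2}" for f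
    have closedK: "closedin (prod_topology ?W ?W) (K f)" if "f \<in> test_functions N" for f
      unfolding K_def
      by (intro closedin_Collect_real_le continuous_map_diff)
        (use that in \<open>auto intro!: continuous_map_compose[OF continuous_map_fst continuous_map_weak_star_eval, unfolded comp_def]
          continuous_map_compose[OF continuous_map_snd continuous_map_weak_star_eval, unfolded comp_def]\<close>)
    have "compactin ?W C" "compactin ?W D"
      unfolding C_def D_def using cl_dom S T
      by (auto intro!: closed_compactin[OF compactin_dominated])
    then have comp: "compactin (prod_topology ?W ?W) (C \<times> D)"
      by (simp add: compactin_Times)
    have ex: "\<exists>f\<in>test_functions N. d / 2 < \<mu> f - \<nu> f" if "\<mu> \<in> C" "\<nu> \<in> D" for \<mu> \<nu>
    proof -
      have "d \<le> d_TV N \<mu> \<nu>"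
        unfolding d_def d_TV_set_def using cINF_lower[OF bdd, of "(\<mu>, \<nu>)"] that by auto
      then have "d / 2 < (SUP f\<in>test_functions N. \<mu> f - \<nu> f)"
        using pos by (simp add: d_TV_def d_def)
      moreover have "test_functions N \<noteq> {}" using zero_test_function by blast
      ultimately show ?thesis
        using less_cSUP_iff[OF _ d_TV_bdd_above[OF _ _ sp], of \<mu> \<nu> "d/2"] CD that by blast
    qed
    \<comment> \<open>By \<open>ex\<close> the closed sets \<open>K f\<close> have no common point
      in the compact product \<open>C \<times> D\<close>; by the finite intersection property
      finitely many of them already have none.\<close>
    have "\<exists>F. finite F \<and> F \<subseteq> test_functions N \<and> C \<times> D \<inter> \<Inter> (K ` F) = {}"
    proof (rule ccontr)
      assume neg: "\<not> ?thesis"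
      have "C \<times> D \<inter> \<Inter> (K ` test_functions N) \<noteq> {}"
      proof (rule comp[unfolded compactin_fip, THEN conjunct2, rule_format], intro conjI ballI allI impI)
        fix F' assume "finite F' \<and> F' \<subseteq> K ` test_functions N"
        then obtain F where "finite F" "F \<subseteq> test_functions N" "F' = K ` F"
          by (meson finite_subset_image)
        then show "C \<times> D \<inter> \<Inter> F' \<noteq> {}" using neg by auto
      qed (use closedK in auto)
      then show False using ex by (fastforce simp: K_def)
    qed
    then obtain F where F: "finite F" "F \<subseteq> test_functions N" "C \<times> D \<inter> \<Inter> (K ` F) = {}" by blast
    \<comment> \<open>Adding the zero function ensures nonemptiness, which the minimax theorem
      requires.\<close>
    define F' where "F' = insert (\<lambda>_. 0) F"
    define Z where "Z = ?H (?ba S) \<times> ?H (?ba T)"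
    have ZCD: "Z \<subseteq> C \<times> D" using sub S T by (auto simp: Z_def C_def D_def)
    have Zba: "fst p \<in> ba N" "snd p \<in> ba N" if "p \<in> Z" for p
    proof -
      have "p \<in> C \<times> D" using that ZCD by blast
      then have "fst p \<in> dominated N" "snd p \<in> dominated N" using CD by auto
      then show "fst p \<in> ba N" "snd p \<in> ba N" by (auto simp: dominated_def)
    qed
    have "\<exists>g\<in>test_functions N. \<forall>p\<in>Z. d / 4 \<le> fst p g - snd p g"
    proof (rule finite_minimax[of F' "test_functions N" "d / 4" "d / 2"])
      show "d / 4 < d / 2" using pos by (simp add: d_def)
      fix f g and t :: real assume fg: "f \<in> test_functions N" "g \<in> test_functions N" and t: "0 \<le> t" "t \<le> 1"
      \<comment> \<open>By linearity the concavity requirement holds with equality for the convex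
        combination of the two test functions.\<close>
      have lin: "\<mu> (\<lambda>x. t * f x + (1 - t) * g x) = t * \<mu> f + (1 - t) * \<mu> g" if "\<mu> \<in> ba N" for \<mu>
        using that fg bdd_meas_scale[of _ N] by (simp add: ba_def)
      show "\<exists>h\<in>test_functions N. \<forall>p\<in>Z. t * (fst p f - snd p f) + (1 - t) * (fst p g - snd p g) \<le> fst p h - snd p h"
        by (rule bexI[OF _ test_functions_convex[OF fg t]])
          (use Zba lin in \<open>auto simp: algebra_simps\<close>)
    next
      fix p q and s :: real assume pq: "p \<in> Z" "q \<in> Z" and s: "0 \<le> s" "s \<le> 1"
      define y where "y = ((\<lambda>f\<in>bdd_meas N. s * fst p f + (1 - s) * fst q f), (\<lambda>f\<in>bdd_meas N. s * snd p f + (1 - s) * snd q f))"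
      have "y \<in> Z" using pq s by (auto simp: Z_def y_def intro!: hull_convex)
      moreover have "fst y f - snd y f \<le> s * (fst p f - snd p f) + (1 - s) * (fst q f - snd q f)"
        if "f \<in> test_functions N" for f
        using that by (simp add: y_def algebra_simps)
      ultimately show "\<exists>y\<in>Z. \<forall>f\<in>test_functions N. fst y f - snd y f \<le> s * (fst p f - snd p f) + (1 - s) * (fst q f - snd q f)"
        by blast
    next
      fix p assume p: "p \<in> Z"
      then have "p \<notin> \<Inter> (K ` F)" using F(3) ZCD by blast
      moreover have "p \<in> topspace (prod_topology ?W ?W)" using Zba[OF p] by (cases p) (auto simp: topspace_weak_star)
      ultimately show "\<exists>f\<in>F'. d / 2 \<le> fst p f - snd p f" by (force simp: K_def F'_def)
    qed (use F zero_test_function in \<open>auto simp: F'_def\<close>)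
    then obtain g where g: "g \<in> test_functions N" "\<And>p. p \<in> Z \<Longrightarrow> d / 4 \<le> fst p g - snd p g" by blast
    have sep: "d / 4 \<le> (\<integral>x. g x \<partial>P) - (\<integral>x. g x \<partial>Q)" if "P \<in> S" "Q \<in> T" for P Q
      using g(2)[of "(ba_of N P, ba_of N Q)"] inc that S T g(1) by (auto simp: Z_def ba_of_def)
    \<comment> \<open>The least threshold above all values on \<open>T\<close>. It is finite because
      any single law in \<open>S\<close> bounds these values, and it stays \<open>d / 4\<close>
      below every value on \<open>S\<close>.\<close>
    define c where "c = (SUP Q\<in>T. \<integral>x. g x \<partial>Q)"
    obtain P0 where P0: "P0 \<in> S" using S by auto
    have b: "bdd_above ((\<lambda>Q. \<integral>x. g x \<partial>Q) ` T)"
    proof (rule bdd_aboveI2)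
      fix Q assume "Q \<in> T"
      then show "(\<integral>x. g x \<partial>Q) \<le> (\<integral>x. g x \<partial>P0) - d / 4" using sep[OF P0] by force
    qed
    show "\<exists>f\<in>test_functions N. \<exists>c. \<exists>\<delta>>0. (\<forall>P\<in>S. c + \<delta> \<le> (\<integral>x. f x \<partial>P)) \<and> (\<forall>Q\<in>T. (\<integral>x. f x \<partial>Q) \<le> c)"
    proof (rule bexI[OF _ g(1)], rule exI[of _ c], rule exI[of _ "d/4"], intro conjI ballI)
      show "0 < d / 4" using pos by (simp add: d_def)
      fix P assume P: "P \<in> S"
      have "c \<le> (\<integral>x. g x \<partial>P) - d / 4"
        unfolding c_def by (rule cSUP_least) (use T sep[OF P] in force)+
      then show "c + d / 4 \<le> (\<integral>x. g x \<partial>P)" by simp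
    next
      fix Q assume "Q \<in> T"
      then show "(\<integral>x. g x \<partial>Q) \<le> c" unfolding c_def by (rule cSUP_upper[OF _ b])
    qed
  next
    assume "\<exists>f\<in>test_functions N. \<exists>c. \<exists>\<delta>>0. (\<forall>P\<in>S. c + \<delta> \<le> (\<integral>x. f x \<partial>P)) \<and> (\<forall>Q\<in>T. (\<integral>x. f x \<partial>Q) \<le> c)"
    then obtain f c \<delta> where f: "f \<in> test_functions N" and "\<delta> > 0"
      and P: "\<And>P. P \<in> S \<Longrightarrow> c + \<delta> \<le> (\<integral>x. f x \<partial>P)" and Q: "\<And>Q. Q \<in> T \<Longrightarrow> (\<integral>x. f x \<partial>Q) \<le> c" by blast
    have fb: "f \<in> bdd_meas N" using f by simp
    note ev = continuous_map_weak_star_eval[OF fb]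
    have "C \<subseteq> {\<mu> \<in> topspace ?W. c + \<delta> \<le> \<mu> f}"
      unfolding C_def
    proof (rule closure_of_minimal)
      show "?H (?ba S) \<subseteq> {\<mu> \<in> topspace ?W. c + \<delta> \<le> \<mu> f}"
      proof
        fix \<mu> assume \<mu>: "\<mu> \<in> ?H (?ba S)"
        then have "\<mu> \<in> topspace ?W" using dom[OF S(1)] by (auto simp: topspace_weak_star dominated_def)
        moreover have "c + \<delta> \<le> \<mu> f"
          by (rule hull_eval_ge[OF _ fb \<mu>]) (use P fb in \<open>auto simp: ba_of_def\<close>)
        ultimately show "\<mu> \<in> {\<mu> \<in> topspace ?W. c + \<delta> \<le> \<mu> f}" by simp
      qed
    qed (intro closedin_Collect_real_le ev; simp)
    moreover have "D \<subseteq> {\<mu> \<in> topspace ?W. \<mu> f \<le> c}"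
      unfolding D_def
    proof (rule closure_of_minimal)
      show "?H (?ba T) \<subseteq> {\<mu> \<in> topspace ?W. \<mu> f \<le> c}"
      proof
        fix \<mu> assume \<mu>: "\<mu> \<in> ?H (?ba T)"
        then have "\<mu> \<in> topspace ?W" using dom[OF T(1)] by (auto simp: topspace_weak_star dominated_def)
        moreover have "\<mu> f \<le> c"
          by (rule hull_eval_le[OF _ fb \<mu>]) (use Q fb in \<open>auto simp: ba_of_def\<close>)
        ultimately show "\<mu> \<in> {\<mu> \<in> topspace ?W. \<mu> f \<le> c}" by simp
      qed
    qed (intro closedin_Collect_real_le ev; simp)
    ultimately have ge: "\<delta> \<le> \<mu> f - \<nu> f" if "\<mu> \<in> C" "\<nu> \<in> D" for \<mu> \<nu> using that by fastforce
    have "\<delta> \<le> d_TV_set N C D"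
      unfolding d_TV_set_def
    proof (rule cINF_greatest)
      fix p assume p: "p \<in> C \<times> D"
      obtain \<mu> \<nu> where p_eq: "p = (\<mu>, \<nu>)" by (cases p)
      have "\<mu> f - \<nu> f \<le> d_TV N \<mu> \<nu>"
        unfolding d_TV_def by (rule cSUP_upper[OF f d_TV_bdd_above[OF _ _ sp]]) (use p p_eq CD in auto)
      then show "\<delta> \<le> (case p of (\<mu>, \<nu>) \<Rightarrow> d_TV N \<mu> \<nu>)" using ge p p_eq by force
    qed (use ne in auto)
    then show "0 < d_TV_set N C D" using \<open>\<delta> > 0\<close> by simp
  qed
qed

section \<open>Blocks of coordinates\<close>

lemma
  assumes "sets R = sets M"
  shows sets_iid_prod_cong: "sets (iid_prod n R) = sets (iid_prod n M)"
    and sets_iid_seq_cong: "sets (iid_seq R) = sets (iid_seq M)"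
  using assms by (auto simp: iid_prod_def iid_seq_def intro!: sets_PiM_cong)

lemma iid_prod_in_prob_algebra:
  assumes "R \<in> space (prob_algebra M)"
  shows "iid_prod n R \<in> space (prob_algebra (iid_prod n M))"
  using assms by (auto simp: space_prob_algebra iid_prod_def intro!: prob_space_PiM sets_PiM_cong)

lemma prob_space_iid_seq: "prob_space R \<Longrightarrow> prob_space (iid_seq R)"
  by (auto simp: iid_seq_def intro!: prob_space_PiM)

section \<open>The coordinate filtration\<close>

lemma space_coord_filtration [simp]: "space (coord_filtration M t) = space (iid_seq M)"
  unfolding coord_filtration_def by (rule space_measure_of) auto

lemma sets_coord_filtration:
  "sets (coord_filtration M t) = sigma_sets (space (iid_seq M))
     {{\<omega> \<in> space (iid_seq M). \<omega> i \<in> B} | i B. enat i < t \<and> B \<in> sets M}"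
  unfolding coord_filtration_def by (rule sets_measure_of) auto

lemma coord_filtration_mono: "s \<le> t \<Longrightarrow> sets (coord_filtration M s) \<subseteq> sets (coord_filtration M t)"
  unfolding sets_coord_filtration by (intro sigma_sets_mono') (auto dest: less_le_trans)

lemma sets_coord_filtration_subset: "sets (coord_filtration M t) \<subseteq> sets (iid_seq M)"
  unfolding sets_coord_filtration
proof (rule sets.sigma_sets_subset, safe)
  fix i B assume "B \<in> sets M"
  then show "{\<omega> \<in> space (iid_seq M). \<omega> i \<in> B} \<in> sets (iid_seq M)"
    unfolding iid_seq_def by measurable
qed

lemma measurable_coordinate:
  assumes "enat i < t"
  shows "(\<lambda>\<omega>. \<omega> i) \<in> coord_filtration M t \<rightarrow>\<^sub>M M"
proof (rule measurableI)
  fix B assume "B \<in> sets M"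
  then have "{\<omega> \<in> space (iid_seq M). \<omega> i \<in> B} \<in> sets (coord_filtration M t)"
    using assms unfolding sets_coord_filtration by (intro sigma_sets.Basic) auto
  also have "{\<omega> \<in> space (iid_seq M). \<omega> i \<in> B} = (\<lambda>\<omega>. \<omega> i) -` B \<inter> space (coord_filtration M t)"
    by auto
  finally show "(\<lambda>\<omega>. \<omega> i) -` B \<inter> space (coord_filtration M t) \<in> sets (coord_filtration M t)" .
qed (auto simp: iid_seq_def space_PiM)

text \<open>Each block is reindexed to start at 0, so that all blocks of length \<open>n\<close>
  take values in the same space \<open>iid_prod n M\<close>.\<close>

definition block :: "nat \<Rightarrow> nat \<Rightarrow> (nat \<Rightarrow> 'a) \<Rightarrow> nat \<Rightarrow> 'a" where
  "block n j \<omega> = (\<lambda>i\<in>{..<n}. \<omega> (j * n + i))"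

text \<open>The last index read by block \<open>j\<close> is \<open>Suc j * n - 1\<close> when
  \<open>n\<close> is positive, and \<open>coord_filtration M t\<close> contains exactly the
  coordinates with index below \<open>t\<close>.\<close>

lemma measurable_block:
  assumes "enat (Suc j * n) \<le> t"
  shows "block n j \<in> coord_filtration M t \<rightarrow>\<^sub>M iid_prod n M"
  unfolding block_def iid_prod_def
proof (intro measurable_restrict measurable_coordinate)
  fix i assume "i \<in> {..<n}"
  then have "enat (j * n + i) < enat (Suc j * n)" by simp
  then show "enat (j * n + i) < t" using assms by (rule less_le_trans)
qed

lemma measurable_block_iid_seq: "block n j \<in> iid_seq M \<rightarrow>\<^sub>M iid_prod n M"
  unfolding block_def iid_prod_def iid_seq_def by measurable

text \<open>The preimages under the first block form a sigma-algebra containing the generators of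
  the filtration at time \<open>n\<close>. This turns events on sequences into events on
  \<open>n\<close> observations.\<close>

lemma coord_filtration_vimage_block:
  assumes "E \<in> sets (coord_filtration M (enat n))"
  obtains B where "B \<in> sets (iid_prod n M)" "E = block n 0 -` B \<inter> space (iid_seq M)"
proof -
  let ?V = "vimage_algebra (space (iid_seq M)) (block n 0) (iid_prod n M)"
  have into: "block n 0 \<in> space (iid_seq M) \<rightarrow> space (iid_prod n M)"
    using measurable_space[OF measurable_block_iid_seq] by auto
  have "sigma_sets (space (iid_seq M)) {{\<omega> \<in> space (iid_seq M). \<omega> i \<in> B} | i B. enat i < enat n \<and> B \<in> sets M}
      \<subseteq> sets ?V"
  proof (rule sets.sigma_sets_subset[of _ ?V, simplified], safe)
    fix i B assume "enat i < enat n" and B: "B \<in> sets M"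
    then have i: "i < n" by simp
    have "{x \<in> space (iid_prod n M). x i \<in> B} \<in> sets (iid_prod n M)"
      using i B measurable_sets[OF measurable_component_singleton[of i "{..<n}" "\<lambda>_. M"] B]
      by (simp add: iid_prod_def vimage_def Int_def conj_commute)
    then have "block n 0 -` {x \<in> space (iid_prod n M). x i \<in> B} \<inter> space (iid_seq M) \<in> sets ?V"
      by (rule in_vimage_algebra)
    also have "block n 0 -` {x \<in> space (iid_prod n M). x i \<in> B} \<inter> space (iid_seq M) =
        {\<omega> \<in> space (iid_seq M). \<omega> i \<in> B}"
      using i into by (auto simp: block_def)
    finally show "{\<omega> \<in> space (iid_seq M). \<omega> i \<in> B} \<in> sets ?V" .
  qed
  then have "E \<in> sets ?V" using assms by (auto simp: sets_coord_filtration)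
  then show thesis using that by (auto simp: sets_vimage_algebra2[OF into])
qed

section \<open>Laws and independence of blocks, and concentration\<close>

lemma distr_block:
  assumes "prob_space P"
  shows "distr (iid_seq P) (iid_prod n P) (block n j) = iid_prod n P"
  using distr_PiM_reindex[of UNIV "\<lambda>_. P" "\<lambda>i. j * n + i" "{..<n}"] assms
  by (simp add: iid_seq_def iid_prod_def block_def[abs_def] inj_on_def)

text \<open>Independence amounts to the joint law being the product of the marginals; here the joint
  map is the identity on a product space.\<close>

lemma indep_vars_coordinates:
  assumes "prob_space P"
  shows "prob_space.indep_vars (iid_seq P) (\<lambda>_. P) (\<lambda>i \<omega>. \<omega> i) UNIV"
proof -
  interpret prob_space "iid_seq P" using assms by (rule prob_space_iid_seq)
  have rv: "(\<lambda>\<omega>. \<omega> i) \<in> iid_seq P \<rightarrow>\<^sub>M P" for i unfolding iid_seq_def by measurable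
  have "distr (iid_seq P) P (\<lambda>\<omega>. \<omega> i) = P" for i
    unfolding iid_seq_def using assms by (intro distr_PiM_component) auto
  then show ?thesis
    by (subst indep_vars_iff_distr_eq_PiM) (auto simp: rv restrict_UNIV iid_seq_def distr_id2)
qed

lemma indep_vars_block:
  assumes "prob_space P"
  shows "prob_space.indep_vars (iid_seq P) (\<lambda>_. iid_prod n P) (block n) UNIV"
proof -
  interpret prob_space "iid_seq P" using assms by (rule prob_space_iid_seq)
  \<comment> \<open>Block \<open>j\<close> is a function of the coordinates in \<open>?K j\<close>,
    and these index sets are disjoint, so independence of the coordinates passes to the
    blocks.\<close>
  let ?K = "\<lambda>j. {j * n..<Suc j * n}"
  have "disjoint_family_on ?K UNIV"
  proof (unfold disjoint_family_on_def, intro ballI impI)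
    fix i j :: nat assume "i \<noteq> j"
    then have "Suc i \<le> j \<or> Suc j \<le> i" by auto
    then have "Suc i * n \<le> j * n \<or> Suc j * n \<le> i * n" using mult_le_mono1 by blast
    then show "?K i \<inter> ?K j = {}" by auto
  qed
  then have "indep_vars (\<lambda>j. PiM (?K j) (\<lambda>_. P)) (\<lambda>j \<omega>. restrict (\<lambda>i. \<omega> i) (?K j)) UNIV"
    by (intro indep_vars_restrict[OF indep_vars_coordinates[OF assms]]) auto
  then have "indep_vars (\<lambda>_. iid_prod n P) (\<lambda>j \<omega>. (\<lambda>x. \<lambda>i\<in>{..<n}. x (j * n + i)) (restrict (\<lambda>i. \<omega> i) (?K j))) UNIV"
    unfolding iid_prod_def
    by (rule indep_vars_compose2) (intro measurable_restrict measurable_component_singleton; simp)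
  also have "(\<lambda>j \<omega>. (\<lambda>x. \<lambda>i\<in>{..<n}. x (j * n + i)) (restrict (\<lambda>i. \<omega> i) (?K j))) = block n"
    by (auto simp: block_def fun_eq_iff)
  finally show ?thesis .
qed

text \<open>The values of \<open>f\<close> on successive blocks are independent, lie in the unit
  interval and share the mean of \<open>f\<close> under the \<open>n\<close>-fold product.\<close>

lemma hoeffding_blocks:
  assumes P: "prob_space P" and f: "f \<in> borel_measurable (iid_prod n P)"
    and f01: "\<And>x. x \<in> space (iid_prod n P) \<Longrightarrow> 0 \<le> f x \<and> f x \<le> (1::real)"
    and "0 < k" "0 \<le> \<delta>"
  shows "measure (iid_seq P) {\<omega> \<in> space (iid_seq P). real k * ((\<integral>x. f x \<partial>iid_prod n P) + \<delta>) \<le> (\<Sum>j<k. f (block n j \<omega>))}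
      \<le> exp (- 2 * real k * \<delta>\<^sup>2)" (is ?ge)
    and "measure (iid_seq P) {\<omega> \<in> space (iid_seq P). (\<Sum>j<k. f (block n j \<omega>)) \<le> real k * ((\<integral>x. f x \<partial>iid_prod n P) - \<delta>)}
      \<le> exp (- 2 * real k * \<delta>\<^sup>2)" (is ?le)
proof -
  interpret prob_space "iid_seq P" using P by (rule prob_space_iid_seq)
  have ex: "expectation (\<lambda>\<omega>. f (block n j \<omega>)) = (\<integral>x. f x \<partial>iid_prod n P)" for j
    using integral_distr[OF measurable_block_iid_seq f, of j] by (simp add: distr_block[OF P])
  interpret Hoeffding_ineq "iid_seq P" "{..<k}" "\<lambda>j \<omega>. f (block n j \<omega>)" "\<lambda>_. 0" "\<lambda>_. 1"
    "\<Sum>j<k. expectation (\<lambda>\<omega>. f (block n j \<omega>))"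
  proof unfold_locales
    show "indep_vars (\<lambda>_. borel) (\<lambda>j \<omega>. f (block n j \<omega>)) {..<k}"
      by (rule indep_vars_compose2[OF indep_vars_subset[OF indep_vars_block[OF P]] f]) auto
    show "AE \<omega> in iid_seq P. f (block n j \<omega>) \<in> {0..1}" for j
      using f01 measurable_space[OF measurable_block_iid_seq[of n j P]] by (intro AE_I2) auto
  qed auto
  \<comment> \<open>Hoeffding's exponent for deviation \<open>k * \<delta>\<close> of a sum of
    \<open>k\<close> terms with range of length 1.\<close>
  have eq: "2 * (real k * \<delta>)\<^sup>2 / real k = 2 * real k * \<delta>\<^sup>2"
    using \<open>0 < k\<close> by (simp add: power2_eq_square)
  show ?ge using Hoeffding_ineq_ge[of "real k * \<delta>"] assms(4,5)
    by (simp add: ex eq distrib_left)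
  show ?le using Hoeffding_ineq_le[of "real k * \<delta>"] assms(4,5)
    by (simp add: ex eq right_diff_distrib)
qed

text \<open>The event is that the average of \<open>f\<close> over \<open>k\<close> blocks falls
  below the midpoint \<open>c + \<delta> / 2\<close>. Under either family an error means a deviation
  of at least \<open>\<delta> / 2\<close> from the mean, and the Hoeffding bound depends only on
  \<open>k\<close> and \<open>\<delta>\<close>, so one \<open>k\<close> serves all laws.\<close>

lemma separated_imp_events:
  assumes S: "S \<subseteq> space (prob_algebra M)" and T: "T \<subseteq> space (prob_algebra M)"
    and f: "f \<in> borel_measurable (iid_prod n M)"
    and f01: "\<And>x. x \<in> space (iid_prod n M) \<Longrightarrow> 0 \<le> f x \<and> f x \<le> (1::real)"
    and sep: "\<And>P. P \<in> S \<Longrightarrow> c + \<delta> \<le> (\<integral>x. f x \<partial>iid_prod n P)"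
      "\<And>Q. Q \<in> T \<Longrightarrow> (\<integral>x. f x \<partial>iid_prod n Q) \<le> c"
    and "0 < \<delta>" "0 < \<eta>" "1 \<le> n"
  shows "\<exists>N\<ge>1. \<exists>E\<in>sets (coord_filtration M (enat N)).
    (\<forall>P\<in>S. measure (iid_seq P) E \<le> \<eta>) \<and> (\<forall>Q\<in>T. 1 - \<eta> \<le> measure (iid_seq Q) E)"
proof -
  \<comment> \<open>Solving \<open>exp (- 2 * k * (\<delta> / 2)\<^sup>2) \<le> \<eta>\<close> for
    \<open>k\<close>; the successor makes \<open>k\<close> positive.\<close>
  obtain k0 :: nat where k0: "- ln \<eta> / (2 * (\<delta> / 2)\<^sup>2) < real k0" using reals_Archimedean2 by blast
  define k where "k = Suc k0"
  have "- ln \<eta> / (2 * (\<delta> / 2)\<^sup>2) \<le> real k" using k0 by (simp add: k_def)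
  then have "- ln \<eta> \<le> real k * (2 * (\<delta> / 2)\<^sup>2)" using \<open>0 < \<delta>\<close> by (subst (asm) divide_le_eq) auto
  then have "- 2 * real k * (\<delta> / 2)\<^sup>2 \<le> ln \<eta>" by (simp only: mult_ac)
  then have small: "exp (- 2 * real k * (\<delta> / 2)\<^sup>2) \<le> \<eta>"
    using \<open>0 < \<eta>\<close> by (metis exp_le_cancel_iff exp_ln)
  have "0 < k" by (simp add: k_def)
  define E where "E = {\<omega> \<in> space (iid_seq M). (\<Sum>j<k. f (block n j \<omega>)) < real k * (c + \<delta> / 2)}"
  have meas_sum: "(\<lambda>\<omega>. \<Sum>j<k. f (block n j \<omega>)) \<in> borel_measurable (coord_filtration M (enat (k * n)))"
  proof (intro borel_measurable_sum measurable_compose[OF measurable_block f])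
    fix j assume "j \<in> {..<k}"
    then have "Suc j * n \<le> k * n" by (intro mult_le_mono1) simp
    then show "enat (Suc j * n) \<le> enat (k * n)" by simp
  qed
  have E: "E \<in> sets (coord_filtration M (enat (k * n)))"
    using borel_measurable_less[OF meas_sum borel_measurable_const[of "real k * (c + \<delta> / 2)"]] by (simp add: E_def)
  have "measure (iid_seq P) E \<le> \<eta>" if P: "P \<in> S" for P
  proof -
    have "prob_space P" and s: "sets P = sets M" using P S by (auto simp: space_prob_algebra)
    interpret prob_space "iid_seq P" using \<open>prob_space P\<close> by (rule prob_space_iid_seq)
    note cong = sets_iid_prod_cong[OF s, of n] sets_iid_seq_cong[OF s]
    note sp = cong[THEN sets_eq_imp_space_eq]
    let ?G = "{\<omega> \<in> space (iid_seq P). (\<Sum>j<k. f (block n j \<omega>)) \<le> real k * ((\<integral>x. f x \<partial>iid_prod n P) - \<delta> / 2)}"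
    have fP: "f \<in> borel_measurable (iid_prod n P)" using f by (simp add: measurable_cong_sets[OF cong(1)])
    have "real k * (c + \<delta> / 2) \<le> real k * ((\<integral>x. f x \<partial>iid_prod n P) - \<delta> / 2)"
      using sep(1)[OF P] by (intro mult_left_mono) auto
    then have "E \<subseteq> ?G" using sp by (auto simp: E_def)
    moreover have "?G \<in> events"
      by (intro borel_measurable_le borel_measurable_sum measurable_compose[OF measurable_block_iid_seq fP]) auto
    ultimately have "prob E \<le> prob ?G" by (intro finite_measure_mono)
    also have "\<dots> \<le> exp (- 2 * real k * (\<delta> / 2)\<^sup>2)"
      using \<open>0 < k\<close> \<open>0 < \<delta>\<close> f01 sp by (intro hoeffding_blocks(2) \<open>prob_space P\<close> fP) auto
    finally show ?thesis using small by linarith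
  qed
  moreover have "1 - \<eta> \<le> measure (iid_seq Q) E" if Q: "Q \<in> T" for Q
  proof -
    have "prob_space Q" and s: "sets Q = sets M" using Q T by (auto simp: space_prob_algebra)
    interpret prob_space "iid_seq Q" using \<open>prob_space Q\<close> by (rule prob_space_iid_seq)
    note cong = sets_iid_prod_cong[OF s, of n] sets_iid_seq_cong[OF s]
    note sp = cong[THEN sets_eq_imp_space_eq]
    let ?G = "{\<omega> \<in> space (iid_seq Q). real k * ((\<integral>x. f x \<partial>iid_prod n Q) + \<delta> / 2) \<le> (\<Sum>j<k. f (block n j \<omega>))}"
    have fQ: "f \<in> borel_measurable (iid_prod n Q)" using f by (simp add: measurable_cong_sets[OF cong(1)])
    have "real k * ((\<integral>x. f x \<partial>iid_prod n Q) + \<delta> / 2) \<le> real k * (c + \<delta> / 2)"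
      using sep(2)[OF Q] by (intro mult_left_mono) auto
    then have "space (iid_seq Q) - E \<subseteq> ?G" using sp by (auto simp: E_def)
    moreover have "?G \<in> events"
      by (intro borel_measurable_le borel_measurable_sum measurable_compose[OF measurable_block_iid_seq fQ]) auto
    ultimately have "prob (space (iid_seq Q) - E) \<le> prob ?G" by (intro finite_measure_mono)
    also have "\<dots> \<le> exp (- 2 * real k * (\<delta> / 2)\<^sup>2)"
      using \<open>0 < k\<close> \<open>0 < \<delta>\<close> f01 sp by (intro hoeffding_blocks(1) \<open>prob_space Q\<close> fQ) auto
    finally have "prob (space (iid_seq Q) - E) \<le> \<eta>" using small by linarith
    moreover have "E \<in> events" using E sets_coord_filtration_subset cong(2) by auto
    ultimately show ?thesis by (simp add: prob_compl)
  qed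
  ultimately show ?thesis
    using E \<open>0 < k\<close> \<open>1 \<le> n\<close> by (intro exI[of _ "k * n"] conjI bexI[of _ E]) (auto simp: Suc_le_eq)
qed

text \<open>Stopping by time \<open>s\<close> means that some \<open>E p\<close> with
  \<open>N p \<le> s\<close> occurs, and each such event is known by time \<open>s\<close>. If no
  event occurs, the infimum over the empty set is infinity.\<close>

lemma sequential_test_first_event:
  fixes N :: "nat \<Rightarrow> nat" and E :: "nat \<Rightarrow> (nat \<Rightarrow> 'a) set"
  assumes N: "\<And>p. 1 \<le> N p" and E: "\<And>p. E p \<in> sets (coord_filtration M (enat (N p)))"
  defines "\<tau> \<equiv> \<lambda>\<omega>. INF p\<in>{p. \<omega> \<in> E p}. enat (N p)"
  shows "sequential_test M \<tau>"
    and "{\<omega> \<in> space (iid_seq M). \<tau> \<omega> < \<infinity>} = (\<Union>p. E p)"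
proof -
  have sub: "E p \<subseteq> space (iid_seq M)" for p using sets.sets_into_space[OF E[of p]] by simp
  have le_iff: "\<tau> \<omega> \<le> enat s \<longleftrightarrow> (\<exists>p. N p \<le> s \<and> \<omega> \<in> E p)" for \<omega> s
  proof
    assume le: "\<tau> \<omega> \<le> enat s"
    then obtain p where "\<omega> \<in> E p"
      unfolding \<tau>_def by (cases "{p. \<omega> \<in> E p} = {}") (simp_all add: top_enat_def, blast)
    \<comment> \<open>The infimum of a nonempty set of extended naturals is attained.\<close>
    then have "\<tau> \<omega> \<in> (\<lambda>p. enat (N p)) ` {p. \<omega> \<in> E p}"
      unfolding \<tau>_def by (intro wellorder_InfI[of "enat (N p)"]) auto
    then show "\<exists>p. N p \<le> s \<and> \<omega> \<in> E p" using le by auto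
  next
    assume "\<exists>p. N p \<le> s \<and> \<omega> \<in> E p"
    then show "\<tau> \<omega> \<le> enat s" unfolding \<tau>_def by (auto intro: INF_lower2)
  qed
  have "stopping_time (coord_filtration M) \<tau>"
    unfolding stopping_time_def
  proof
    fix t
    show "Measurable.pred (coord_filtration M t) (\<lambda>\<omega>. \<tau> \<omega> \<le> t)"
    proof (cases t)
      case (enat s)
      have "{\<omega> \<in> space (coord_filtration M t). \<tau> \<omega> \<le> t} = (\<Union>p\<in>{p. N p \<le> s}. E p)"
        using sub by (auto simp: enat le_iff)
      also have "\<dots> \<in> sets (coord_filtration M t)"
        using E coord_filtration_mono[of "enat (N _)" t M] by (intro sets.countable_UN'') (auto simp: enat)
      finally show ?thesis by (simp add: pred_def)
    qed simp
  qed
  moreover have "1 \<le> \<tau> \<omega>" for \<omega>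
    unfolding \<tau>_def by (rule INF_greatest) (use N in \<open>simp add: one_enat_def\<close>)
  ultimately show "sequential_test M \<tau>" by (simp add: sequential_test_def)
  have "\<tau> \<omega> < \<infinity> \<longleftrightarrow> (\<exists>s. \<tau> \<omega> \<le> enat s)" for \<omega>
    by (cases "\<tau> \<omega>") auto
  then have "\<tau> \<omega> < \<infinity> \<longleftrightarrow> (\<exists>p. \<omega> \<in> E p)" for \<omega>
    using le_iff[of \<omega>] by auto
  then show "{\<omega> \<in> space (iid_seq M). \<tau> \<omega> < \<infinity>} = (\<Union>p. E p)" using sub by auto
qed

section \<open>Testability and separation\<close>

lemma d_TV_weak_star_hull_pos_iff:
  assumes "\<P> \<subseteq> space (prob_algebra M)" "\<P> \<noteq> {}" "\<A> \<subseteq> space (prob_algebra M)" "\<A> \<noteq> {}"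
  shows "0 < d_TV_set (iid_prod n M) (weak_star_hull M n \<P>) (weak_star_hull M n \<A>) \<longleftrightarrow>
    (\<exists>f\<in>test_functions (iid_prod n M). \<exists>c. \<exists>\<delta>>0.
      (\<forall>P\<in>\<P>. c + \<delta> \<le> (\<integral>x. f x \<partial>iid_prod n P)) \<and> (\<forall>Q\<in>\<A>. (\<integral>x. f x \<partial>iid_prod n Q) \<le> c))"
proof -
  have "iid_prod n ` \<P> \<subseteq> space (prob_algebra (iid_prod n M))" "iid_prod n ` \<A> \<subseteq> space (prob_algebra (iid_prod n M))"
    using assms(1,3) iid_prod_in_prob_algebra[of _ M n] by blast+
  with d_TV_set_pos_iff[of "iid_prod n ` \<P>" "iid_prod n M" "iid_prod n ` \<A>"] assms(2,4)
  show ?thesis by (simp add: weak_star_hull_def image_image)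
qed

text \<open>If \<open>E\<close> is the event of having stopped by time \<open>n\<close>, then
  \<open>f\<close> is the indicator of continuing, read as a function of the first block, whose law
  is the \<open>n\<close>-fold product.\<close>

lemma continuation_test_function:
  assumes E: "E \<in> sets (coord_filtration M (enat n))"
  obtains f where "f \<in> test_functions (iid_prod n M)"
    "\<And>R. R \<in> space (prob_algebra M) \<Longrightarrow> (\<integral>x. f x \<partial>iid_prod n R) = 1 - measure (iid_seq R) E"
proof -
  obtain B where B: "B \<in> sets (iid_prod n M)" "E = block n 0 -` B \<inter> space (iid_seq M)"
    using E by (rule coord_filtration_vimage_block)
  define f :: "(nat \<Rightarrow> 'a) \<Rightarrow> real" where "f = indicator (space (iid_prod n M) - B)"
  show thesis
  proof
    show "f \<in> test_functions (iid_prod n M)"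
      unfolding f_def using B(1) by (intro test_functionsI) (auto simp: indicator_def)
    fix R assume "R \<in> space (prob_algebra M)"
    then have R: "prob_space R" "sets R = sets M" by (auto simp: space_prob_algebra)
    note cong = sets_iid_prod_cong[OF R(2), of n] sets_iid_seq_cong[OF R(2)]
    note sp = cong[THEN sets_eq_imp_space_eq]
    interpret P: prob_space "iid_prod n R"
      unfolding iid_prod_def using R(1) by (intro prob_space_PiM)
    have "measure (iid_seq R) E = measure (distr (iid_seq R) (iid_prod n R) (block n 0)) B"
      using B cong sp by (subst measure_distr) (auto intro: measurable_block_iid_seq)
    also have "\<dots> = measure (iid_prod n R) B" by (simp add: distr_block[OF R(1)])
    finally show "(\<integral>x. f x \<partial>iid_prod n R) = 1 - measure (iid_seq R) E"
      using P.prob_compl[of B] B(1) cong by (simp add: f_def Int_absorb2 flip: sp(1))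
  qed
qed

lemma sequentially_testable_imp_separated:
  assumes P: "\<P> \<subseteq> space (prob_algebra M)" "\<P> \<noteq> {}"
    and Q: "\<Q> \<subseteq> space (prob_algebra M)" "\<Q> \<noteq> {}"
    and "sequentially_testable M \<P> \<Q>"
  shows "\<exists>(\<A> :: nat \<Rightarrow> 'a measure set) (n :: nat \<Rightarrow> nat).
       (\<forall>m. \<A> m \<noteq> {} \<and> \<A> m \<subseteq> \<Q> \<and> 1 \<le> n m) \<and> \<Q> = (\<Union>m. \<A> m) \<and>
       (\<forall>m. 0 < d_TV_set (iid_prod (n m) M) (weak_star_hull M (n m) \<P>) (weak_star_hull M (n m) (\<A> m)))"
proof -
  obtain \<alpha> \<tau> where \<alpha>: "0 < \<alpha>" "\<alpha> < 1" and \<tau>: "sequential_test M \<tau>" "level_test \<alpha> \<P> \<tau>"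
    and power: "\<And>Q. Q \<in> \<Q> \<Longrightarrow> power_one Q \<tau>"
    using assms(5) unfolding sequentially_testable_def by blast
  define E where "E s = {\<omega> \<in> space (iid_seq M). \<tau> \<omega> \<le> enat s}" for s
  have E: "E s \<in> sets (coord_filtration M (enat s))" for s
    using \<tau>(1) by (auto simp: sequential_test_def stopping_time_def pred_def E_def)
  have "incseq E" by (rule monoI) (auto simp: E_def intro: order_trans)
  \<comment> \<open>The threshold is the midpoint between the level \<open>\<alpha>\<close> and 1:
    it is reached eventually by every alternative and never by a null law.\<close>
  define B where "B s = {Q \<in> \<Q>. (1 + \<alpha>) / 2 < measure (iid_seq Q) (E s)}" for s
  have rej: "{\<omega> \<in> space (iid_seq M). \<tau> \<omega> < \<infinity>} = (\<Union>s. E s)"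
  proof -
    have "\<tau> \<omega> < \<infinity> \<longleftrightarrow> (\<exists>s. \<tau> \<omega> \<le> enat s)" for \<omega> by (cases "\<tau> \<omega>") auto
    then show ?thesis by (auto simp: E_def)
  qed
  have events: "E s \<in> sets (iid_seq R)" "rejection_prob \<tau> R = measure (iid_seq R) (\<Union>s. E s)"
    "prob_space (iid_seq R)" if "R \<in> space (prob_algebra M)" for R s
  proof -
    have R: "prob_space R" "sets R = sets M" using that by (auto simp: space_prob_algebra)
    note s = sets_iid_seq_cong[OF R(2)]
    show "E s \<in> sets (iid_seq R)" using E sets_coord_filtration_subset s by auto
    show "rejection_prob \<tau> R = measure (iid_seq R) (\<Union>s. E s)"
      unfolding rejection_prob_def sets_eq_imp_space_eq[OF s] rej ..
    show "prob_space (iid_seq R)" using R(1) by (rule prob_space_iid_seq)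
  qed
  have cover: "\<exists>s. Q \<in> B s" if "Q \<in> \<Q>" for Q
  proof -
    have QM: "Q \<in> space (prob_algebra M)" using that Q by auto
    interpret prob_space "iid_seq Q" using QM by (rule events)
    \<comment> \<open>Continuity from below: the probability of rejecting by time \<open>s\<close>
      tends to the power, which is 1.\<close>
    have "(\<lambda>s. prob (E s)) \<longlonglongrightarrow> prob (\<Union>s. E s)"
      using events(1)[OF QM] by (intro finite_Lim_measure_incseq \<open>incseq E\<close>) auto
    moreover have "prob (\<Union>s. E s) = 1"
      using power[OF that] events(2)[OF QM] by (simp add: power_one_def)
    ultimately have "eventually (\<lambda>s. (1 + \<alpha>) / 2 < prob (E s)) sequentially"
      using \<alpha>(2) by (intro order_tendstoD(1)) auto
    then show ?thesis using that by (auto simp: B_def eventually_sequentially)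
  qed
  have B_mono: "B s \<subseteq> B t" if "s \<le> t" for s t
  proof
    fix Q assume QB: "Q \<in> B s"
    then have QM: "Q \<in> space (prob_algebra M)" using Q by (auto simp: B_def)
    interpret prob_space "iid_seq Q" using QM by (rule events)
    have "prob (E s) \<le> prob (E t)"
      using \<open>incseq E\<close> that events(1)[OF QM] by (intro finite_measure_mono) (auto dest: monoD)
    then show "Q \<in> B t" using QB by (auto simp: B_def)
  qed
  obtain s0 where s0: "B s0 \<noteq> {}" using Q(2) cover by blast
  \<comment> \<open>Starting beyond \<open>s0\<close> keeps every subfamily nonempty, and the
    successor makes every sample size positive.\<close>
  define n where "n m = Suc (s0 + m)" for m
  define \<A> where "\<A> m = B (n m)" for m
  have ne: "\<A> m \<noteq> {}" for m using s0 B_mono[of s0 "n m"] by (auto simp: \<A>_def n_def)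
  have sub: "\<A> m \<subseteq> \<Q>" for m by (auto simp: \<A>_def B_def)
  have pos: "0 < d_TV_set (iid_prod (n m) M) (weak_star_hull M (n m) \<P>) (weak_star_hull M (n m) (\<A> m))" for m
  proof -
    obtain f where f: "f \<in> test_functions (iid_prod (n m) M)"
      "\<And>R. R \<in> space (prob_algebra M) \<Longrightarrow> (\<integral>x. f x \<partial>iid_prod (n m) R) = 1 - measure (iid_seq R) (E (n m))"
      using E by (rule continuation_test_function) blast
    \<comment> \<open>Threshold and gap are both \<open>(1 - \<alpha>) / 2\<close>: the probability
      of continuing is at least \<open>1 - \<alpha>\<close> under a null law and below half of that
      on \<open>\<A> m\<close>.\<close>
    have "(1 - \<alpha>) / 2 + (1 - \<alpha>) / 2 \<le> (\<integral>x. f x \<partial>iid_prod (n m) P)" if "P \<in> \<P>" for P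
    proof -
      have PM: "P \<in> space (prob_algebra M)" using that P by auto
      interpret prob_space "iid_seq P" using PM by (rule events)
      have "prob (E (n m)) \<le> prob (\<Union>s. E s)"
        using events(1)[OF PM] by (intro finite_measure_mono) auto
      also have "\<dots> \<le> \<alpha>"
        using \<tau>(2) that unfolding level_test_def events(2)[OF PM, symmetric] by blast
      finally show ?thesis by (simp add: f(2)[OF PM] field_simps)
    qed
    moreover have "(\<integral>x. f x \<partial>iid_prod (n m) R) \<le> (1 - \<alpha>) / 2" if "R \<in> \<A> m" for R
    proof -
      have "R \<in> space (prob_algebra M)" using that sub Q by blast
      then show ?thesis using that by (simp add: f(2) \<A>_def B_def field_simps)
    qed
    moreover have "0 < (1 - \<alpha>) / 2" using \<alpha> by simp
    ultimately show ?thesis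
      using f(1) Q sub ne by (subst d_TV_weak_star_hull_pos_iff[OF P]) blast+
  qed
  have "\<Q> = (\<Union>m. \<A> m)"
  proof
    show "\<Q> \<subseteq> (\<Union>m. \<A> m)"
    proof
      fix Q assume "Q \<in> \<Q>"
      then obtain s where "Q \<in> B s" using cover by blast
      then have "Q \<in> \<A> s" using B_mono[of s "n s"] by (auto simp: \<A>_def n_def)
      then show "Q \<in> (\<Union>m. \<A> m)" by blast
    qed
  qed (use sub in blast)
  then show ?thesis using ne sub pos by (intro exI[of _ \<A>] exI[of _ n]) (auto simp: n_def)
qed

lemma separated_imp_sequentially_testable:
  fixes \<A> :: "nat \<Rightarrow> 'a measure set" and n :: "nat \<Rightarrow> nat"
  assumes P: "\<P> \<subseteq> space (prob_algebra M)" "\<P> \<noteq> {}"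
    and Q: "(\<Union>m. \<A> m) \<subseteq> space (prob_algebra M)" and ne: "\<And>m. \<A> m \<noteq> {}" and n: "\<And>m. 1 \<le> n m"
    and sep: "\<And>m. 0 < d_TV_set (iid_prod (n m) M) (weak_star_hull M (n m) \<P>) (weak_star_hull M (n m) (\<A> m))"
  shows "sequentially_testable M \<P> (\<Union>m. \<A> m)"
proof -
  \<comment> \<open>The errors sum to 1/2. The index \<open>p\<close> encodes a pair of a subfamily
    \<open>m\<close> and an attempt \<open>j\<close>, so each subfamily is tested infinitely often
    with error tending to 0.\<close>
  define \<eta> :: "nat \<Rightarrow> real" where "\<eta> p = (1 / 2) ^ (p + 2)" for p
  have "\<exists>N\<ge>1. \<exists>E\<in>sets (coord_filtration M (enat N)). (\<forall>P\<in>\<P>. measure (iid_seq P) E \<le> \<eta> p) \<and>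
      (\<forall>Q\<in>\<A> (fst (prod_decode p)). 1 - \<eta> p \<le> measure (iid_seq Q) E)" for p
  proof -
    define m where "m = fst (prod_decode p)"
    have Am: "\<A> m \<subseteq> space (prob_algebra M)" using Q by blast
    obtain f c \<delta> where f: "f \<in> test_functions (iid_prod (n m) M)" and \<delta>: "0 < \<delta>"
      and "\<forall>P\<in>\<P>. c + \<delta> \<le> (\<integral>x. f x \<partial>iid_prod (n m) P)" "\<forall>Q\<in>\<A> m. (\<integral>x. f x \<partial>iid_prod (n m) Q) \<le> c"
      using sep[of m] unfolding d_TV_weak_star_hull_pos_iff[OF P Am ne] by blast
    then show ?thesis
      unfolding m_def[symmetric] using n[of m]
      by (intro separated_imp_events[OF P(1) Am, of f "n m" c \<delta>]) (auto simp: \<eta>_def bdd_meas_def)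
  qed
  then obtain N E where N: "\<And>p. 1 \<le> N p" and E: "\<And>p. E p \<in> sets (coord_filtration M (enat (N p)))"
    and EP: "\<And>p P. P \<in> \<P> \<Longrightarrow> measure (iid_seq P) (E p) \<le> \<eta> p"
    and EQ: "\<And>p Q. Q \<in> \<A> (fst (prod_decode p)) \<Longrightarrow> 1 - \<eta> p \<le> measure (iid_seq Q) (E p)"
    by metis
  define \<tau> where "\<tau> \<omega> = (INF p\<in>{p. \<omega> \<in> E p}. enat (N p))" for \<omega>
  note test = sequential_test_first_event[of N E, OF N E, folded \<tau>_def]
  have events: "E p \<in> sets (iid_seq R)" "rejection_prob \<tau> R = measure (iid_seq R) (\<Union>p. E p)"
    "prob_space (iid_seq R)" if "R \<in> space (prob_algebra M)" for R p
  proof -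
    have R: "prob_space R" "sets R = sets M" using that by (auto simp: space_prob_algebra)
    note s = sets_iid_seq_cong[OF R(2)]
    show "E p \<in> sets (iid_seq R)" using E sets_coord_filtration_subset s by blast
    show "rejection_prob \<tau> R = measure (iid_seq R) (\<Union>p. E p)"
      unfolding rejection_prob_def sets_eq_imp_space_eq[OF s] test(2) ..
    show "prob_space (iid_seq R)" using R(1) by (rule prob_space_iid_seq)
  qed
  have sums: "\<eta> sums (1 / 2)"
    using sums_mult[OF geometric_sums[of "1 / 2 :: real"], of "1 / 4"] by (simp add: \<eta>_def[abs_def])
  have "rejection_prob \<tau> P \<le> 1 / 2" if "P \<in> \<P>" for P
  proof -
    have PM: "P \<in> space (prob_algebra M)" using that P by auto
    interpret prob_space "iid_seq P" using PM by (rule events)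
    have s: "summable (\<lambda>p. prob (E p))"
      using EP[OF that] by (intro summable_comparison_test[OF _ sums_summable[OF sums]]) auto
    \<comment> \<open>The union bound over all pairs gives level 1/2.\<close>
    have "prob (\<Union>p. E p) \<le> (\<Sum>p. prob (E p))"
      using events(1)[OF PM] by (intro finite_measure_subadditive_countably s) auto
    also have "\<dots> \<le> (\<Sum>p. \<eta> p)" by (intro suminf_le EP[OF that] s sums_summable[OF sums])
    finally show ?thesis by (simp add: events(2)[OF PM] sums_unique[OF sums, symmetric])
  qed
  moreover have "rejection_prob \<tau> R = 1" if "R \<in> \<A> m" for R m
  proof -
    have RM: "R \<in> space (prob_algebra M)" using that Q by auto
    interpret prob_space "iid_seq R" using RM by (rule events)
    \<comment> \<open>The code of \<open>(m, j)\<close> is at least \<open>j\<close>, so attempt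
      \<open>j\<close> at the subfamily of \<open>R\<close> misses with probability at most
      \<open>(1 / 2) ^ j\<close>; letting \<open>j\<close> grow gives power one.\<close>
    have "1 - (1 / 2) ^ j \<le> prob (\<Union>p. E p)" for j
    proof -
      let ?p = "prod_encode (m, j)"
      have "\<eta> ?p \<le> (1 / 2) ^ j"
        unfolding \<eta>_def using le_prod_encode_2[of j m] by (intro power_decreasing) auto
      moreover have "1 - \<eta> ?p \<le> prob (E ?p)" using that by (intro EQ) simp
      moreover have "prob (E ?p) \<le> prob (\<Union>p. E p)"
        using events(1)[OF RM] by (intro finite_measure_mono) auto
      ultimately show ?thesis by linarith
    qed
    moreover have "(\<lambda>j. 1 - (1 / 2) ^ j :: real) \<longlonglongrightarrow> 1 - 0"
      by (intro tendsto_intros LIMSEQ_power_zero) simp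
    ultimately have "1 \<le> prob (\<Union>p. E p)"
      by (intro LIMSEQ_le_const2[of "\<lambda>j. 1 - (1 / 2) ^ j"]) auto
    then show ?thesis unfolding events(2)[OF RM] by (intro antisym prob_le_1)
  qed
  ultimately show ?thesis
    unfolding sequentially_testable_def level_test_def power_one_def
    using test(1) by (intro exI[of _ "1 / 2 :: real"] conjI exI[of _ \<tau>]) auto
qed

theorem corollary3p9:
  fixes M :: "'a measure" and \<P> \<Q> :: "'a measure set"
  assumes "\<P> \<subseteq> space (prob_algebra M)" and "\<P> \<noteq> {}"
    and "\<Q> \<subseteq> space (prob_algebra M)" and "\<Q> \<noteq> {}"
  shows "sequentially_testable M \<P> \<Q> \<longleftrightarrow>
    (\<exists>(\<A> :: nat \<Rightarrow> 'a measure set) (n :: nat \<Rightarrow> nat).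
       (\<forall>m. \<A> m \<noteq> {} \<and> \<A> m \<subseteq> \<Q> \<and> 1 \<le> n m) \<and>
       \<Q> = (\<Union>m. \<A> m) \<and>
       (\<forall>m. 0 < d_TV_set (iid_prod (n m) M)
                  (weak_star_hull M (n m) \<P>) (weak_star_hull M (n m) (\<A> m))))"
  using sequentially_testable_imp_separated[OF assms]
    separated_imp_sequentially_testable[of \<P> M] assms(1-3) by metis

end
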